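(* Let $0<\alpha<1$, $x>0$ and $y\in C^\infty[0,x]$, and put $h=x/n$ for integers $n\ge 2$. Then, as $n\to\infty$ with $x$ fixed, the following asymptotic expansion holds: $$\frac{1}{h^\alpha}\sum_{k=1}^{n-1}\frac{y(x-kh)}{k^{1+\alpha}}\sim\Gamma(-\alpha)y^{(\alpha)}(x)-\frac{y(0)}{\alpha x^\alpha}-\frac{y(0)h}{2x^{1+\alpha}}+\sum_{m=0}^{\infty}\frac{(-1)^m}{m!}\zeta(1+\alpha-m)y^{(m)}(x)h^{m-\alpha}$$ $$-\sum_{m=1}^{\infty}\frac{B_{2m}}{(2m)!}\left(\sum_{k=0}^{2m-1}\binom{2m-1}{k}\frac{\Gamma(1+\alpha+k)}{\Gamma(1+\alpha)}\frac{y^{(2m-1-k)}(0)}{x^{1+\alpha+k}}\right)h^{2m}.$$ That is, for every integer $N\ge 1$, if the first infinite sum is truncated to $0\le m\le N$ and the second to $1\le m\le\lfloor N/2\rfloor$, then the difference between the left side and the resulting right side is $O(h^N)$.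
   Context: $\zeta$ is the Riemann zeta function (analytically continued), $B_{2m}$ are the Bernoulli numbers, and $y^{(m)}$ with integer $m$ is the ordinary $m$-th derivative. For $0<\alpha<1$ the Caputo derivative is $y^{(\alpha)}(x)=\frac{1}{\Gamma(1-\alpha)}\int_0^x\frac{y'(t)}{(x-t)^\alpha}\,dt$. The constant implied by $O(\cdot)$ may depend on $y,\alpha,x,N$ but not on $n$. *)

theory Defs
  imports "HOL-Complex_Analysis.Complex_Analysis" "HOL-Library.Landau_Symbols"
begin

text \<open>
  Derivatives are taken relative to a set \<open>S\<close>, so that on a compact interval they are one-sided
  at the endpoints and no values of the function outside the interval matter.
\<close>

primrec nth_deriv_on :: "real set \<Rightarrow> nat \<Rightarrow> (real \<Rightarrow> real) \<Rightarrow> real \<Rightarrow> real" where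
  "nth_deriv_on S 0 f = f"
| "nth_deriv_on S (Suc k) f = (\<lambda>t. vector_derivative (nth_deriv_on S k f) (at t within S))"

definition smooth_on :: "real set \<Rightarrow> (real \<Rightarrow> real) \<Rightarrow> bool" where
  "smooth_on S f \<longleftrightarrow> (\<forall>k. nth_deriv_on S k f differentiable_on S)"

text \<open>
  The integrand takes the junk value \<open>0\<close> at the singularity \<open>t = x\<close>, which does not affect
  the integral.
\<close>

definition caputo_deriv :: "real \<Rightarrow> (real \<Rightarrow> real) \<Rightarrow> real \<Rightarrow> real" where
  "caputo_deriv \<alpha> f x =
     1 / Gamma (1 - \<alpha>) * integral {0..x} (\<lambda>t. nth_deriv_on {0..x} 1 f t / (x - t) powr \<alpha>)"

fun bernoulli :: "nat \<Rightarrow> real" where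
  "bernoulli 0 = 1"
| "bernoulli (Suc n) = - (\<Sum>k\<le>n. real ((n + 2) choose k) * bernoulli k) / real (n + 2)"

lemma sum_bernoulli:
  assumes "n \<ge> 1"
  shows "(\<Sum>k\<le>n. real (Suc n choose k) * bernoulli k) = 0"
proof -
  obtain m where m: "n = Suc m"
    using assms by (cases n) auto
  have "Suc (Suc m) choose Suc m = m + 2"
    using binomial_symmetric[of "Suc m" "Suc (Suc m)"] by simp
  then show ?thesis
    by (simp add: m field_simps del: binomial_Suc_Suc)
qed

text \<open>
  The Riemann zeta function is the analytic continuation of the Dirichlet series to the punctured
  plane. Only its value at the pole is left unspecified: by \<open>zeta_continuation_unique\<close> the
  continuation is determined everywhere else.
\<close>

definition is_zeta_continuation :: "(complex \<Rightarrow> complex) \<Rightarrow> bool" where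
  "is_zeta_continuation f \<longleftrightarrow>
     f holomorphic_on (- {1}) \<and>
     (\<forall>s. Re s > 1 \<longrightarrow> (\<lambda>n. of_nat (Suc n) powr (- s)) sums f s)"

definition zeta :: "complex \<Rightarrow> complex" where
  "zeta = (SOME f. is_zeta_continuation f)"

lemma zeta_continuation_unique:
  assumes "is_zeta_continuation f" "is_zeta_continuation g" "s \<noteq> 1"
  shows "f s = g s"
proof -
  have hol: "(\<lambda>z. f z - g z) holomorphic_on (- {1})"
    using assms by (auto simp: is_zeta_continuation_def intro!: holomorphic_intros)
  have "f s - g s = 0"
  proof (rule analytic_continuation[OF hol, where U = "{z. Re z > 1}" and \<xi> = 2])
    show "connected (- {1 :: complex})"
      by (intro connected_punctured_universe) simp
    show "(2 :: complex) islimpt {z. Re z > 1}"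
      by (intro interior_limit_point) (simp add: interior_open open_halfspace_Re_gt)
    show "f z - g z = 0" if "z \<in> {z. Re z > 1}" for z
      using that assms by (auto simp: is_zeta_continuation_def dest: sums_unique2)
  qed (use assms in auto)
  then show ?thesis by simp
qed

end

theory Submission
  imports Defs
begin

text \<open>
  With \<open>h = x / n\<close> the left-hand side is the Riemann sum \<open>\<Sum>i<n. h * g (i * h)\<close>, without the node
  \<open>0\<close>, of the function \<open>g t = t powr - (1 + \<alpha>) * y (x - t)\<close>. This function is smooth at \<open>t = x\<close>
  and has a non-integrable power singularity at \<open>t = 0\<close>, so the statement is an Euler-Maclaurin formula
  for a singular integrand. Its endpoint \<open>x\<close> contributes the usual Bernoulli terms; the integral has to be
  read as a finite part, which integration by parts turns into the Caputo derivative; and the endpoint \<open>0\<close>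
  contributes zeta values.

  To see the last point, expand \<open>y (x - t)\<close> at \<open>t = 0\<close> in powers of \<open>t\<close>. For a single power, \<open>g\<close>
  is homogeneous, and the claim reduces to the expansion of \<open>\<Sum>i<n. i powr - s\<close> for
  \<open>s = 1 + \<alpha> - m\<close>, whose constant term is \<open>\<zeta>(s)\<close> (\<open>em_defect_monomial_bigo\<close>). For the Taylor
  remainder of order \<open>K\<close> the singularity is so weak that the ordinary Euler-Maclaurin estimate on
  \<open>{h..x}\<close> leaves an error of order \<open>h powr (K - \<alpha>)\<close> (\<open>em_defect_remainder_bigo\<close>). Since the
  difference between the sum and the terms at \<open>x\<close> is linear in the function, the two cases combine to
  \<open>em_defect_expansion\<close>; the theorem is the case \<open>K = N + 1\<close>.

  Both cases rest on one estimate, \<open>euler_maclaurin_bound\<close>, for functions given by a chain of successive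
  derivatives that starts with an antiderivative. Its proof is Taylor's formula together with the recursion
  of the Bernoulli numbers. Applied to \<open>t powr - s\<close> with complex \<open>s\<close>, the same estimate shows that the zeta function has an analytic continuation, as the locally
  uniform limit of \<open>\<Sum>i<n. i powr - s\<close> minus its Euler-Maclaurin terms at \<open>n\<close>
  (\<open>ex_zeta_continuation\<close>), and it identifies the continued values with the constant terms needed
  (\<open>zeta_approx_error\<close>).
\<close>

section \<open>Bernoulli numbers\<close>

text \<open>
  The recursion of the Bernoulli numbers divided by \<open>p!\<close>: it says that the power series
  \<open>\<Sum>k. B\<^sub>k X\<^sup>k / k!\<close> is inverse to \<open>(e\<^sup>X - 1) / X\<close>, and it is the only
  property of these numbers that the Euler-Maclaurin formula rests on.
\<close>
lemma bernoulli_convolution: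
  assumes "p \<ge> 1"
  shows "(\<Sum>k<p. bernoulli k / fact k / fact (p - k)) = (if p = 1 then 1 else 0)"
proof (cases "p = 1")
  case False
  with assms have p: "p - 1 \<ge> 1" "p = Suc (p - 1)" by auto
  have "(\<Sum>k<p. bernoulli k / fact k / fact (p - k))
      = (\<Sum>k\<le>p - 1. real (Suc (p - 1) choose k) * bernoulli k) / fact p"
    unfolding sum_divide_distrib
  proof (rule sum.cong)
    show "{..<p} = {..p - 1}" using p(2) by (metis lessThan_Suc_atMost)
    show "bernoulli k / fact k / fact (p - k) = real (Suc (p - 1) choose k) * bernoulli k / fact p"
      if "k \<in> {..p - 1}" for k
      using that p(2) binomial_fact[of k p, where ?'a = real] by (simp add: field_simps)
  qed
  with sum_bernoulli[OF p(1)] False show ?thesis by simp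
qed simp

text \<open>
  The generating function \<open>B(X) = \<Sum>k. B\<^sub>k X\<^sup>k / k!\<close> satisfies
  \<open>B(X) (e\<^sup>X - 1) = X\<close>. Replacing \<open>X\<close> by \<open>-X\<close> gives
  \<open>B(-X) = X e\<^sup>X / (e\<^sup>X - 1) = B(X) + X\<close>, so \<open>B(X) + X/2\<close> is even.
\<close>
lemma bernoulli_odd_eq_0:
  assumes "odd n" "n \<noteq> 1"
  shows "bernoulli n = 0"
proof -
  define B where "B = Abs_fps (\<lambda>k. bernoulli k / fact k)"
  define B' where "B' = Abs_fps (\<lambda>k. (-1) ^ k * (bernoulli k / fact k))"
  have conv: "(\<Sum>k\<le>p. bernoulli k / fact k * (if p = k then 0 else 1 / fact (p - k)))
      = (if p = 1 then 1 else 0)" for p :: nat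
  proof (cases "p = 0")
    case False
    have "(\<Sum>k\<le>p. bernoulli k / fact k * (if p = k then 0 else 1 / fact (p - k)))
        = (\<Sum>k<p. bernoulli k / fact k / fact (p - k))"
      by (simp add: mult.commute flip: lessThan_Suc_atMost)
    with bernoulli_convolution[of p] False show ?thesis by simp
  qed simp
  have exp1: "(fps_exp 1 - 1) $ i = (if i = 0 then 0 else 1 / fact i :: real)" for i
    by (cases i) (auto simp: algebra_simps)
  have expm1: "(fps_exp (-1) - 1) $ i = (-1) ^ i * (if i = 0 then 0 else 1 / fact i :: real)" for i
    by (cases i) (auto simp: algebra_simps)
  have B: "B * (fps_exp 1 - 1) = fps_X"
  proof (rule fps_ext)
    fix p
    have "(B * (fps_exp 1 - 1)) $ p
        = (\<Sum>k\<le>p. bernoulli k / fact k * (if p = k then 0 else 1 / fact (p - k)))"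
      unfolding fps_mult_nth B_def atLeast0AtMost by (intro sum.cong) (auto simp: exp1)
    then show "(B * (fps_exp 1 - 1)) $ p = fps_X $ p" unfolding conv by simp
  qed
  have B': "B' * (fps_exp (-1) - 1) = - fps_X"
  proof (rule fps_ext)
    fix p
    have "(B' * (fps_exp (-1) - 1)) $ p
        = (\<Sum>k\<le>p. (-1) ^ p * (bernoulli k / fact k * (if p = k then 0 else 1 / fact (p - k))))"
      unfolding fps_mult_nth B'_def atLeast0AtMost
    proof (intro sum.cong)
      fix k assume "k \<in> {..p}"
      then have "(-1) ^ p = (-1 :: real) ^ k * (-1) ^ (p - k)" by (simp flip: power_add)
      then show "Abs_fps (\<lambda>k. (- 1) ^ k * (bernoulli k / fact k)) $ k * (fps_exp (- 1) - 1) $ (p - k) =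
         (- 1) ^ p * (bernoulli k / fact k * (if p = k then 0 else 1 / fact (p - k)))"
        using \<open>k \<in> {..p}\<close> by (auto simp: expm1)
    qed simp
    also have "\<dots> = (- fps_X) $ p"
      unfolding sum_distrib_left[symmetric] conv by simp
    finally show "(B' * (fps_exp (-1) - 1)) $ p = (- fps_X) $ p" .
  qed
  have E: "fps_exp (-1) * fps_exp 1 = (1 :: real fps)"
    by (simp flip: fps_exp_add_mult)
  have ne: "fps_exp 1 - 1 \<noteq> (0 :: real fps)"
    using exp1[of 1] by auto
  have "B' * (fps_exp 1 - 1) = - (B' * (fps_exp (-1) - 1)) * fps_exp 1"
    using E by (simp add: algebra_simps)
  also have "\<dots> = (B + fps_X) * (fps_exp 1 - 1)"
    unfolding B' using B by (simp add: algebra_simps)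
  finally have "B' = B + fps_X" using ne by simp
  then have "B' $ n = (B + fps_X) $ n" by simp
  with assms show ?thesis by (simp add: B_def B'_def)
qed

section \<open>The Euler-Maclaurin estimate\<close>

text \<open>
  A sequence \<open>D\<close> of functions, each the derivative of the one before, stands for a smooth
  function together with all its derivatives; here and below it may be vector-valued, since the
  same estimate serves \<open>t\<^sup>-\<^sup>s\<close> with complex \<open>s\<close> and real integrands.
\<close>
lemma taylor_remainder_bound:
  fixes D :: "nat \<Rightarrow> real \<Rightarrow> 'a::banach"
  assumes "0 < p" "0 \<le> h"
    and deriv: "\<And>k t. k < p \<Longrightarrow> t \<in> {a..a+h} \<Longrightarrow>
      (D k has_vector_derivative D (Suc k) t) (at t within {a..a+h})"
    and bound: "\<And>t. t \<in> {a..a+h} \<Longrightarrow> norm (D p t) \<le> M"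
  shows "norm (D 0 (a + h) - (\<Sum>j<p. (h ^ j / fact j) *\<^sub>R D j a)) \<le> M * h ^ p"
proof -
  define i where "i = (\<lambda>t. ((a + h - t) ^ (p - 1) / fact (p - 1)) *\<^sub>R D p t)"
  have M: "M \<ge> 0" using bound[of a] \<open>0 \<le> h\<close> norm_ge_zero[of "D p a"] by (simp del: norm_ge_zero)
  have "(i has_integral D 0 (a + h) - (\<Sum>j<p. ((a + h - a) ^ j / fact j) *\<^sub>R D j a)) {a..a+h}"
    unfolding i_def using assms by (intro Taylor_has_integral) auto
  then have "norm (D 0 (a + h) - (\<Sum>j<p. ((a + h - a) ^ j / fact j) *\<^sub>R D j a))
      \<le> (h ^ (p - 1) * M) * measure lborel (cbox a (a + h))"
  proof (intro has_integral_bound)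
    fix t assume t: "t \<in> cbox a (a + h)"
    have "(a + h - t) ^ (p - 1) / fact (p - 1) \<le> h ^ (p - 1) / 1"
      using t by (intro frac_le power_mono) auto
    then show "norm (i t) \<le> h ^ (p - 1) * M"
      unfolding i_def norm_scaleR using t bound[of t] by (intro mult_mono) auto
  qed (use M \<open>0 \<le> h\<close> in auto)
  also have "(h ^ (p - 1) * M) * measure lborel (cbox a (a + h)) = M * h ^ p"
    using assms(1,2) by (cases p) auto
  finally show ?thesis by simp
qed

text \<open>
  \<open>D 0\<close> is an antiderivative of the function \<open>D 1\<close> that is summed, so no integral
  occurs. With \<open>d\<close> for differentiation, the sum over \<open>k\<close> is \<open>B(hd) (e\<^sup>h\<^sup>d - 1)\<close>
  applied to \<open>D 0\<close>, truncated after order \<open>K\<close>; formally this operator is \<open>hd\<close>.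
  Taylor's formula makes this precise: inserting the expansions of \<open>D k (a + h)\<close> leaves
  \<open>h * D 1 a\<close> by the convolution identity, plus the Taylor remainders.
\<close>
lemma euler_maclaurin_step:
  fixes D :: "nat \<Rightarrow> real \<Rightarrow> 'a::banach"
  assumes "K \<ge> 1" "0 \<le> h"
    and deriv: "\<And>k t. k \<le> K \<Longrightarrow> t \<in> {a..a+h} \<Longrightarrow>
      (D k has_vector_derivative D (Suc k) t) (at t within {a..a+h})"
    and bound: "\<And>t. t \<in> {a..a+h} \<Longrightarrow> norm (D (Suc K) t) \<le> M"
  shows "norm (h *\<^sub>R D 1 a - (\<Sum>k\<le>K. (bernoulli k / fact k * h ^ k) *\<^sub>R (D k (a + h) - D k a)))
      \<le> (\<Sum>k\<le>K. \<bar>bernoulli k / fact k\<bar>) * h ^ Suc K * M"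
proof -
  define b where "b = (\<lambda>k. bernoulli k / fact k)"
  define T where "T = (\<lambda>k. \<Sum>j<Suc K - k. (h ^ j / fact j) *\<^sub>R D (k + j) a)"
  have T: "norm (D k (a + h) - T k) \<le> M * h ^ (Suc K - k)" if "k \<le> K" for k
    unfolding T_def using that taylor_remainder_bound[of "Suc K - k" h a "\<lambda>j. D (k + j)" M] assms
    by simp
  have T': "T k - D k a = (\<Sum>p\<in>{k<..K}. (h ^ (p - k) / fact (p - k)) *\<^sub>R D p a)" if "k \<le> K" for k
  proof -
    have "T k = (\<Sum>p=k..K. (h ^ (p - k) / fact (p - k)) *\<^sub>R D p a)"
      unfolding T_def
      by (rule sum.reindex_bij_witness[of _ "\<lambda>p. p - k" "\<lambda>j. k + j"]) (use that in auto)
    also have "{k..K} = insert k {k<..K}" using that by auto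
    finally show ?thesis by simp
  qed
  have "(\<Sum>k\<le>K. (b k * h ^ k) *\<^sub>R (T k - D k a))
      = (\<Sum>k\<le>K. \<Sum>p\<in>{k<..K}. (h ^ p * (b k / fact (p - k))) *\<^sub>R D p a)"
  proof (intro sum.cong refl)
    fix k assume "k \<in> {..K}"
    then show "(b k * h ^ k) *\<^sub>R (T k - D k a)
        = (\<Sum>p\<in>{k<..K}. (h ^ p * (b k / fact (p - k))) *\<^sub>R D p a)"
      by (simp add: T' scaleR_sum_right)
        (intro sum.cong, auto simp: field_simps simp flip: power_add)
  qed
  also have "\<dots> = (\<Sum>p\<le>K. \<Sum>k<p. (h ^ p * (b k / fact (p - k))) *\<^sub>R D p a)"
    unfolding sum.Sigma[OF finite_atMost ballI[OF finite_greaterThanAtMost]]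
      sum.Sigma[OF finite_atMost ballI[OF finite_lessThan]]
    by (rule sum.reindex_bij_witness[of _ "\<lambda>(a, b). (b, a)" "\<lambda>(a, b). (b, a)"]) auto
  also have "\<dots> = (\<Sum>p\<le>K. if p = 1 then h *\<^sub>R D 1 a else 0)"
  proof (intro sum.cong refl)
    fix p
    have "(\<Sum>k<p. (h ^ p * (b k / fact (p - k))) *\<^sub>R D p a)
        = (h ^ p * (\<Sum>k<p. b k / fact (p - k))) *\<^sub>R D p a"
      by (simp add: scaleR_sum_left sum_distrib_left)
    also have "\<dots> = (if p = 1 then h *\<^sub>R D 1 a else 0)"
      using bernoulli_convolution[of p] by (cases "p = 0") (auto simp: b_def)
    finally show "(\<Sum>k<p. (h ^ p * (b k / fact (p - k))) *\<^sub>R D p a)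
        = (if p = 1 then h *\<^sub>R D 1 a else 0)" .
  qed
  also have "\<dots> = h *\<^sub>R D 1 a" using \<open>K \<ge> 1\<close> by simp
  finally have main: "h *\<^sub>R D 1 a = (\<Sum>k\<le>K. (b k * h ^ k) *\<^sub>R (T k - D k a))" ..
  have "h *\<^sub>R D 1 a - (\<Sum>k\<le>K. (b k * h ^ k) *\<^sub>R (D k (a + h) - D k a))
      = - (\<Sum>k\<le>K. (b k * h ^ k) *\<^sub>R (D k (a + h) - T k))"
    unfolding main by (simp add: algebra_simps sum_subtractf flip: sum_negf)
  also have "norm \<dots> \<le> (\<Sum>k\<le>K. \<bar>b k\<bar> * h ^ Suc K * M)"
    unfolding norm_minus_cancel
  proof (rule sum_norm_le)
    fix k assume k: "k \<in> {..K}"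
    have "norm ((b k * h ^ k) *\<^sub>R (D k (a + h) - T k)) \<le> \<bar>b k\<bar> * h ^ k * (M * h ^ (Suc K - k))"
      using T[of k] k \<open>0 \<le> h\<close> by (simp add: abs_mult mult_left_mono)
    also have "\<dots> = \<bar>b k\<bar> * h ^ (k + (Suc K - k)) * M"
      by (simp only: power_add mult_ac)
    also have "k + (Suc K - k) = Suc K" using k by simp
    finally show "norm ((b k * h ^ k) *\<^sub>R (D k (a + h) - T k)) \<le> \<bar>b k\<bar> * h ^ Suc K * M" .
  qed
  finally show ?thesis by (simp add: b_def sum_distrib_right)
qed

text \<open>
  The boundary terms of adjacent cells telescope. The bound \<open>M\<close> may depend on the cell,
  because the integrands of interest grow towards the origin.
\<close>
lemma euler_maclaurin_bound:
  fixes D :: "nat \<Rightarrow> real \<Rightarrow> 'a::banach"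
  assumes "K \<ge> 1" "0 \<le> h" "p \<le> n"
    and deriv: "\<And>k t. k \<le> K \<Longrightarrow> t \<in> {real p * h..real n * h} \<Longrightarrow>
      (D k has_vector_derivative D (Suc k) t) (at t within {real p * h..real n * h})"
    and bound: "\<And>i t. p \<le> i \<Longrightarrow> i < n \<Longrightarrow> t \<in> {real i * h..real (Suc i) * h} \<Longrightarrow>
      norm (D (Suc K) t) \<le> M i"
  shows "norm ((\<Sum>i=p..<n. h *\<^sub>R D 1 (real i * h))
        - (\<Sum>k\<le>K. (bernoulli k / fact k * h ^ k) *\<^sub>R (D k (real n * h) - D k (real p * h))))
      \<le> (\<Sum>k\<le>K. \<bar>bernoulli k / fact k\<bar>) * h ^ Suc K * (\<Sum>i=p..<n. M i)"
proof -
  define S where "S = (\<lambda>i. \<Sum>k\<le>K. (bernoulli k / fact k * h ^ k) *\<^sub>R D k (real i * h))"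
  have tel: "(\<Sum>k\<le>K. (bernoulli k / fact k * h ^ k) *\<^sub>R (D k (real n * h) - D k (real p * h)))
      = (\<Sum>i=p..<n. S (Suc i) - S i)"
    using \<open>p \<le> n\<close> by (subst sum_Suc_diff')
      (simp_all add: S_def scaleR_diff_right sum_subtractf)
  have "norm (\<Sum>i=p..<n. h *\<^sub>R D 1 (real i * h) - (S (Suc i) - S i))
      \<le> (\<Sum>i=p..<n. (\<Sum>k\<le>K. \<bar>bernoulli k / fact k\<bar>) * h ^ Suc K * M i)"
  proof (rule sum_norm_le)
    fix i assume i: "i \<in> {p..<n}"
    have eq: "real i * h + h = real (Suc i) * h" by (simp add: algebra_simps)
    have sub: "{real i * h..real (Suc i) * h} \<subseteq> {real p * h..real n * h}"
      using i \<open>0 \<le> h\<close> by (intro atLeastatMost_subset_iff[THEN iffD2] disjI2 conjI mult_right_mono) auto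
    have "norm (h *\<^sub>R D 1 (real i * h) - (\<Sum>k\<le>K. (bernoulli k / fact k * h ^ k) *\<^sub>R
          (D k (real i * h + h) - D k (real i * h))))
        \<le> (\<Sum>k\<le>K. \<bar>bernoulli k / fact k\<bar>) * h ^ Suc K * M i"
    proof (rule euler_maclaurin_step)
      show "(D k has_vector_derivative D (Suc k) t) (at t within {real i * h..real i * h + h})"
        if "k \<le> K" "t \<in> {real i * h..real i * h + h}" for k t
        using that sub deriv[of k t] unfolding eq
        by (auto intro: has_vector_derivative_within_subset)
      show "norm (D (Suc K) t) \<le> M i" if "t \<in> {real i * h..real i * h + h}" for t
        using that bound[of i t] i unfolding eq by auto
    qed (use assms in auto)
    then show "norm (h *\<^sub>R D 1 (real i * h) - (S (Suc i) - S i))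
        \<le> (\<Sum>k\<le>K. \<bar>bernoulli k / fact k\<bar>) * h ^ Suc K * M i"
      unfolding eq by (simp add: S_def scaleR_diff_right sum_subtractf)
  qed
  then show ?thesis
    unfolding tel by (simp add: sum_subtractf sum_distrib_left)
qed

section \<open>Continuation of the zeta function and power sums\<close>

definition power_coeff :: "complex \<Rightarrow> nat \<Rightarrow> complex" where
  "power_coeff s k = (\<Prod>j<k. 1 - s - of_nat j) / (1 - s)"

text \<open>
  \<open>power_chain s k\<close> is the \<open>k\<close>-th derivative of \<open>t powr (1 - s) / (1 - s)\<close>, the
  antiderivative of \<open>t powr (- s)\<close> that has no constant term.
\<close>
definition power_chain :: "complex \<Rightarrow> nat \<Rightarrow> real \<Rightarrow> complex" where
  "power_chain s k t = power_coeff s k * of_real t powr (1 - s - of_nat k)"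

lemma power_chain_1: "s \<noteq> 1 \<Longrightarrow> power_chain s (Suc 0) t = of_real t powr (- s)"
  by (simp add: power_chain_def power_coeff_def)

lemma power_chain_deriv:
  assumes "t > 0"
  shows "(power_chain s k has_vector_derivative power_chain s (Suc k) t) (at t within A)"
proof -
  have "((\<lambda>z. power_coeff s k * z powr (1 - s - of_nat k)) has_field_derivative
      power_coeff s k * ((1 - s - of_nat k) * of_real t powr (1 - s - of_nat k - 1))) (at (of_real t))"
    using assms by (intro DERIV_cmult has_field_derivative_powr) (simp add: complex_nonpos_Reals_iff)
  from has_vector_derivative_real_field[OF this, of A]
  have "(power_chain s k has_vector_derivative
      power_coeff s k * ((1 - s - of_nat k) * of_real t powr (1 - s - of_nat k - 1))) (at t within A)"
    unfolding power_chain_def .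
  also have "power_coeff s k * ((1 - s - of_nat k) * of_real t powr (1 - s - of_nat k - 1))
      = power_chain s (Suc k) t"
    by (simp add: power_chain_def power_coeff_def diff_diff_eq add.commute)
  finally show ?thesis .
qed

lemma norm_power_chain:
  assumes "t > 0"
  shows "norm (power_chain s k t) = norm (power_coeff s k) * t powr (1 - Re s - real k)"
  using assms by (simp add: power_chain_def norm_mult norm_powr_real_powr)

text \<open>
  What is left of the partial sums of the Dirichlet series after the Euler-Maclaurin terms at the
  upper end are removed. The terms with \<open>k \<le> K\<close> include everything that grows with \<open>n\<close>
  if \<open>Re s > 1 - K\<close>, so the limit exists there and continues the zeta function.
\<close>
definition zeta_approx :: "nat \<Rightarrow> complex \<Rightarrow> nat \<Rightarrow> complex" where
  "zeta_approx K s n = (\<Sum>i=1..<n. of_nat i powr (- s))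
     - (\<Sum>k\<le>K. of_real (bernoulli k / fact k) * power_chain s k (real n))"

lemma norm_zeta_approx_diff:
  assumes "K \<ge> 1" "s \<noteq> 1" "Re s + real K \<ge> 0" "1 \<le> p" "p \<le> n"
  shows "norm (zeta_approx K s n - zeta_approx K s p)
    \<le> (\<Sum>k\<le>K. \<bar>bernoulli k / fact k\<bar>) * norm (power_coeff s (Suc K))
      * (\<Sum>i=p..<n. real i powr - (Re s + real K))"
proof -
  define A where "A = norm (power_coeff s (Suc K))"
  have "norm ((\<Sum>i=p..<n. 1 *\<^sub>R power_chain s 1 (real i * 1))
        - (\<Sum>k\<le>K. (bernoulli k / fact k * 1 ^ k) *\<^sub>R
            (power_chain s k (real n * 1) - power_chain s k (real p * 1))))
      \<le> (\<Sum>k\<le>K. \<bar>bernoulli k / fact k\<bar>) * 1 ^ Suc K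
          * (\<Sum>i=p..<n. A * real i powr - (Re s + real K))"
  proof (rule euler_maclaurin_bound)
    show "norm (power_chain s (Suc K) t) \<le> A * real i powr - (Re s + real K)"
      if "p \<le> i" "i < n" "t \<in> {real i * 1..real (Suc i) * 1}" for i t
    proof -
      have "t > 0" using that \<open>1 \<le> p\<close> by auto
      have "t powr - (Re s + real K) \<le> real i powr - (Re s + real K)"
        using that assms by (intro powr_mono2') auto
      moreover have "1 - Re s - real (Suc K) = - (Re s + real K)" by simp
      ultimately show ?thesis
        using norm_power_chain[OF \<open>t > 0\<close>, of s "Suc K"] by (simp add: A_def mult_left_mono)
    qed
  qed (use assms in \<open>auto intro!: power_chain_deriv\<close>)
  also have "(\<Sum>i=p..<n. 1 *\<^sub>R power_chain s 1 (real i * 1))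
        - (\<Sum>k\<le>K. (bernoulli k / fact k * 1 ^ k) *\<^sub>R
            (power_chain s k (real n * 1) - power_chain s k (real p * 1)))
      = zeta_approx K s n - zeta_approx K s p"
  proof -
    have "(\<Sum>i=1..<n. of_nat i powr (- s))
        = (\<Sum>i=1..<p. of_nat i powr (- s)) + (\<Sum>i=p..<n. of_nat i powr (- s))"
      using assms by (simp add: sum.atLeastLessThan_concat)
    with \<open>s \<noteq> 1\<close> show ?thesis
      by (simp add: zeta_approx_def power_chain_1 right_diff_distrib sum_subtractf
          scaleR_conv_of_real)
  qed
  finally show ?thesis by (simp add: A_def sum_distrib_left mult.assoc)
qed

lemma zeta_approx_holomorphic: "(\<lambda>s. zeta_approx K s n) holomorphic_on - {1}"
  unfolding zeta_approx_def power_chain_def power_coeff_def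
  by (intro holomorphic_intros) auto

definition zeta_lim :: "nat \<Rightarrow> complex \<Rightarrow> complex" where
  "zeta_lim K s = lim (zeta_approx K s)"

text \<open>
  The increments of \<open>zeta_approx K s\<close> are \<open>O(i powr - (Re s + K))\<close> with a constant that
  is continuous in \<open>s\<close>. Near a point with \<open>Re z + K > 1\<close> this exponent stays below
  some \<open>- q < - 1\<close>, and the Weierstrass M-test applies.
\<close>
lemma zeta_approx_uniform_limit:
  assumes "K \<ge> 1" "z \<noteq> 1" "Re z > 1 - real K"
  obtains d where "d > 0" "cball z d \<subseteq> {s. Re s > 1 - real K} - {1}"
    "uniform_limit (cball z d) (\<lambda>n s. zeta_approx K s (Suc n)) (zeta_lim K) sequentially"
proof -
  \<comment> \<open>Any exponent strictly between \<open>1\<close> and \<open>Re z + K\<close> would do.\<close>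
  define q where "q = (Re z + real K + 1) / 2"
  have q: "q > 1" "Re z > q - real K" using assms by (auto simp: q_def field_simps)
  have "open ({s. Re s > q - real K} - {1})"
    by (intro open_Diff open_halfspace_Re_gt) auto
  moreover have "z \<in> {s. Re s > q - real K} - {1}" using q assms by auto
  ultimately obtain d where d: "d > 0" "cball z d \<subseteq> {s. Re s > q - real K} - {1}"
    unfolding open_contains_cball by blast
  define A where "A = (\<lambda>s::complex. (\<Sum>k\<le>K. \<bar>bernoulli k / fact k\<bar>)
    * norm (power_coeff s (Suc K)))"
  have "compact (A ` cball z d)"
    unfolding A_def power_coeff_def using d by (intro compact_continuous_image continuous_intros) auto
  then have "bdd_above (A ` cball z d)"
    by (intro bounded_imp_bdd_above compact_imp_bounded)
  then obtain A' where "\<forall>a\<in>A ` cball z d. a \<le> A'"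
    unfolding bdd_above_def by blast
  then have A': "A s \<le> A'" if "s \<in> cball z d" for s
    using that by blast
  define u where "u = (\<lambda>i s. zeta_approx K s (Suc (Suc i)) - zeta_approx K s (Suc i))"
  have "uniform_limit (cball z d) (\<lambda>n s. \<Sum>i<n. u i s) (\<lambda>s. \<Sum>i. u i s) sequentially"
  proof (rule Weierstrass_m_test)
    show "summable (\<lambda>i. A' * real (Suc i) powr - q)"
      using q by (intro summable_mult) (subst summable_Suc_iff, simp add: summable_real_powr_iff)
    fix i s assume s: "s \<in> cball z d"
    then have s': "Re s > q - real K" "s \<noteq> 1" using d by auto
    have "norm (u i s) \<le> A s * real (Suc i) powr - (Re s + real K)"
      using norm_zeta_approx_diff[of K s "Suc i" "Suc (Suc i)"] assms s' q
      by (simp add: u_def A_def)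
    also have "\<dots> \<le> A' * real (Suc i) powr - q"
    proof (intro mult_mono A' s powr_mono)
      show "0 \<le> A'" using A'[OF s] unfolding A_def
        by (smt (verit) norm_ge_zero mult_nonneg_nonneg sum_nonneg abs_ge_zero)
    qed (use s' in auto)
    finally show "norm (u i s) \<le> A' * real (Suc i) powr - q" .
  qed
  then have "uniform_limit (cball z d) (\<lambda>n s. zeta_approx K s (Suc 0) + (\<Sum>i<n. u i s))
      (\<lambda>s. zeta_approx K s (Suc 0) + (\<Sum>i. u i s)) sequentially"
    by (intro uniform_limit_add uniform_limit_const)
  also have "(\<lambda>n s. zeta_approx K s (Suc 0) + (\<Sum>i<n. u i s)) = (\<lambda>n s. zeta_approx K s (Suc n))"
    unfolding u_def by (subst sum_lessThan_telescope) simp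
  finally have lim: "uniform_limit (cball z d) (\<lambda>n s. zeta_approx K s (Suc n))
      (\<lambda>s. zeta_approx K s (Suc 0) + (\<Sum>i. u i s)) sequentially" .
  have eq: "zeta_approx K s (Suc 0) + (\<Sum>i. u i s) = zeta_lim K s" if "s \<in> cball z d" for s
  proof -
    have "(\<lambda>n. zeta_approx K s (Suc n)) \<longlonglongrightarrow> zeta_approx K s (Suc 0) + (\<Sum>i. u i s)"
      using tendsto_uniform_limitI[OF lim that] .
    then have "zeta_approx K s \<longlonglongrightarrow> zeta_approx K s (Suc 0) + (\<Sum>i. u i s)"
      by (subst (asm) filterlim_sequentially_Suc)
    then show ?thesis by (simp add: zeta_lim_def limI)
  qed
  have "uniform_limit (cball z d) (\<lambda>n s. zeta_approx K s (Suc n)) (zeta_lim K) sequentially"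
    by (rule uniform_limit_cong'[THEN iffD1, OF _ _ lim]) (simp_all add: eq)
  moreover have "cball z d \<subseteq> {s. Re s > 1 - real K} - {1}" using d q by auto
  ultimately show ?thesis using d that by blast
qed

lemma zeta_approx_tendsto_zeta_lim:
  assumes "K \<ge> 1" "s \<noteq> 1" "Re s > 1 - real K"
  shows "zeta_approx K s \<longlonglongrightarrow> zeta_lim K s"
proof -
  obtain d where "d > 0"
    "uniform_limit (cball s d) (\<lambda>n s. zeta_approx K s (Suc n)) (zeta_lim K) sequentially"
    using zeta_approx_uniform_limit[OF assms] by metis
  then have "(\<lambda>n. zeta_approx K s (Suc n)) \<longlonglongrightarrow> zeta_lim K s"
    using tendsto_uniform_limitI by fastforce
  then show ?thesis by (subst (asm) filterlim_sequentially_Suc)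
qed

lemma zeta_lim_holomorphic:
  assumes "K \<ge> 1"
  shows "zeta_lim K holomorphic_on {s. Re s > 1 - real K} - {1}"
proof (rule holomorphic_uniform_sequence)
  show "open ({s. Re s > 1 - real K} - {1})"
    by (intro open_Diff open_halfspace_Re_gt) auto
  show "(\<lambda>s. zeta_approx K s (Suc n)) holomorphic_on {s. Re s > 1 - real K} - {1}" for n
    by (rule holomorphic_on_subset[OF zeta_approx_holomorphic]) auto
  show "\<exists>d>0. cball z d \<subseteq> {s. Re s > 1 - real K} - {1} \<and>
      uniform_limit (cball z d) (\<lambda>n s. zeta_approx K s (Suc n)) (zeta_lim K) sequentially"
    if "z \<in> {s. Re s > 1 - real K} - {1}" for z
    using zeta_approx_uniform_limit[OF assms, of z] that by (metis (no_types, lifting) Diff_iff mem_Collect_eq singletonI)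
qed

lemma power_chain_tendsto_0:
  assumes "Re s > 1 - real k"
  shows "(\<lambda>n. power_chain s k (real n)) \<longlonglongrightarrow> 0"
proof (rule tendsto_norm_zero_cancel)
  have "(\<lambda>n. norm (power_coeff s k) * real n powr (1 - Re s - real k)) \<longlonglongrightarrow> 0"
    using assms by (intro tendsto_mult_right_zero tendsto_neg_powr filterlim_real_sequentially) auto
  then show "(\<lambda>n. norm (power_chain s k (real n))) \<longlonglongrightarrow> 0"
    by (rule Lim_transform_eventually)
      (use eventually_gt_at_top[of 0] in eventually_elim, simp add: norm_power_chain)
qed

text \<open>
  Raising the truncation order from \<open>m\<close> to \<open>Suc m\<close> subtracts a multiple of
  \<open>power_chain s (Suc m) n\<close>, which vanishes in the limit where \<open>Re s > - m\<close>.
\<close>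
lemma zeta_lim_mono:
  assumes "K \<le> K'" "K \<ge> 1" "s \<noteq> 1" "Re s > 1 - real K"
  shows "zeta_lim K' s = zeta_lim K s"
  using assms(1)
proof (induction K' rule: dec_induct)
  case (step m)
  have "(\<lambda>n. zeta_approx m s n
      - of_real (bernoulli (Suc m) / fact (Suc m)) * power_chain s (Suc m) (real n))
      \<longlonglongrightarrow> zeta_lim m s - of_real (bernoulli (Suc m) / fact (Suc m)) * 0"
    using assms step.hyps
    by (intro tendsto_intros zeta_approx_tendsto_zeta_lim power_chain_tendsto_0) auto
  also have "(\<lambda>n. zeta_approx m s n
      - of_real (bernoulli (Suc m) / fact (Suc m)) * power_chain s (Suc m) (real n))
      = zeta_approx (Suc m) s"
    by (simp add: zeta_approx_def fun_eq_iff)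
  finally have "zeta_lim (Suc m) s = zeta_lim m s"
    by (simp add: zeta_lim_def[of "Suc m"] limI)
  with step.IH show ?case by simp
qed simp

text \<open>
  The limits for the various \<open>K\<close> agree where their half-planes overlap and these half-planes
  exhaust the plane. For \<open>Re s > 1\<close> all correction terms vanish in the limit, so the Dirichlet
  series itself remains.
\<close>
lemma ex_zeta_continuation:
  obtains f where "is_zeta_continuation f"
    "\<And>K s. K \<ge> 1 \<Longrightarrow> s \<noteq> 1 \<Longrightarrow> Re s > 1 - real K \<Longrightarrow> f s = zeta_lim K s"
proof -
  \<comment> \<open>For each \<open>s\<close> one admissible truncation order is fixed; the others give the same limit.\<close>
  define k where "k = (\<lambda>s. Suc (nat \<lceil>1 - Re s\<rceil>))"
  define f where "f = (\<lambda>s. zeta_lim (k s) s)"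
  have k: "k s \<ge> 1" "Re s > 1 - real (k s)" for s
    unfolding k_def by linarith+
  have f: "f s = zeta_lim K s" if "K \<ge> 1" "s \<noteq> 1" "Re s > 1 - real K" for K s
    using zeta_lim_mono[of K "max K (k s)" s] zeta_lim_mono[of "k s" "max K (k s)" s] that k[of s]
    by (simp add: f_def)
  have "f holomorphic_on (\<Union>K\<in>{1..}. {s. Re s > 1 - real K} - {1})"
  proof (rule holomorphic_on_UN_open)
    fix K :: nat assume K: "K \<in> {1..}"
    show "open ({s. Re s > 1 - real K} - {1})"
      by (intro open_Diff open_halfspace_Re_gt) auto
    show "f holomorphic_on {s. Re s > 1 - real K} - {1}"
      using zeta_lim_holomorphic[of K] K f by (subst holomorphic_cong[OF refl]) auto
  qed
  also have "(\<Union>K\<in>{1..}. {s. Re s > 1 - real K} - {1}) = - {1}"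
    using k by auto
  finally have hol: "f holomorphic_on - {1}" .
  have "(\<lambda>n. of_nat (Suc n) powr (- s)) sums f s" if "Re s > 1" for s
  proof -
    have s: "s \<noteq> 1" using that by auto
    have "(\<lambda>n. zeta_approx 1 s n
        + (\<Sum>k\<le>1. of_real (bernoulli k / fact k) * power_chain s k (real n)))
        \<longlonglongrightarrow> zeta_lim 1 s + (\<Sum>k\<le>1. of_real (bernoulli k / fact k) * 0)"
      using that s
      by (intro tendsto_intros zeta_approx_tendsto_zeta_lim power_chain_tendsto_0) auto
    then have "(\<lambda>n. \<Sum>i=1..<n. of_nat i powr (- s)) \<longlonglongrightarrow> f s"
      using f[of 1 s] that s by (simp add: zeta_approx_def)
    then have "(\<lambda>n. \<Sum>i=1..<Suc n. of_nat i powr (- s)) \<longlonglongrightarrow> f s"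
      by (subst filterlim_sequentially_Suc)
    then show ?thesis
      unfolding sums_def One_nat_def sum.shift_bounds_Suc_ivl by (simp add: atLeast0LessThan)
  qed
  with hol f that show ?thesis
    unfolding is_zeta_continuation_def by blast
qed

text \<open>
  The constant \<open>zeta\<close> is chosen among all continuations, so it is known to be one only because a
  continuation exists; uniqueness then fixes its values away from the pole.
\<close>
lemma zeta_approx_tendsto_zeta:
  assumes "K \<ge> 1" "s \<noteq> 1" "Re s > 1 - real K"
  shows "zeta_approx K s \<longlonglongrightarrow> zeta s"
proof -
  obtain f where f: "is_zeta_continuation f" "f s = zeta_lim K s"
    using ex_zeta_continuation assms by metis
  have "is_zeta_continuation zeta"
    unfolding zeta_def by (rule someI[of is_zeta_continuation, OF f(1)])
  with f zeta_continuation_unique[of zeta f s] zeta_approx_tendsto_zeta_lim[OF assms] assms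
  show ?thesis by simp
qed

text \<open>
  The tail of the series of increments gives the rate of convergence. The rate \<open>r\<close> is kept
  strictly below the optimal \<open>Re s + K - 1\<close>: then \<open>n powr - r\<close> can be factored out of the
  tail and the full convergent series bounds the rest.
\<close>
lemma zeta_approx_error:
  assumes "K \<ge> 1" "s \<noteq> 1" "r \<ge> 0" "r + 1 < Re s + real K"
  obtains C where "\<And>n. n \<ge> 1 \<Longrightarrow> norm (zeta_approx K s n - zeta s) \<le> C * real n powr - r"
proof -
  define q where "q = Re s + real K"
  define A where "A = (\<Sum>k\<le>K. \<bar>bernoulli k / fact k\<bar>)
    * norm (power_coeff s (Suc K))"
  have A: "A \<ge> 0" unfolding A_def by (intro mult_nonneg_nonneg sum_nonneg) auto
  have summ: "summable (\<lambda>i. real i powr - (q - r))"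
    using assms by (simp add: summable_real_powr_iff q_def)
  show ?thesis
  proof (rule that)
    fix n :: nat assume n: "n \<ge> 1"
    have "norm (zeta_approx K s n - zeta_approx K s m)
        \<le> A * (\<Sum>i. real i powr - (q - r)) * real n powr - r" if "m \<ge> n" for m
    proof -
      have "norm (zeta_approx K s n - zeta_approx K s m) \<le> A * (\<Sum>i=n..<m. real i powr - q)"
        unfolding norm_minus_commute[of "zeta_approx K s n"] A_def q_def
        using assms n that by (intro norm_zeta_approx_diff) auto
      also have "(\<Sum>i=n..<m. real i powr - q) \<le> (\<Sum>i=n..<m. real i powr - (q - r) * real n powr - r)"
      proof (rule sum_mono)
        fix i assume i: "i \<in> {n..<m}"
        have "real i powr - q = real i powr - (q - r) * real i powr - r"
          by (simp flip: powr_add)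
        also have "\<dots> \<le> real i powr - (q - r) * real n powr - r"
          using i n assms by (intro mult_left_mono powr_mono2') auto
        finally show "real i powr - q \<le> real i powr - (q - r) * real n powr - r" .
      qed
      also have "\<dots> \<le> (\<Sum>i. real i powr - (q - r)) * real n powr - r"
        unfolding sum_distrib_right[symmetric]
        by (intro mult_right_mono sum_le_suminf summ) auto
      finally show ?thesis using A by (simp add: mult_left_mono mult.assoc)
    qed
    note le = this
    have "(\<lambda>m. norm (zeta_approx K s n - zeta_approx K s m))
        \<longlonglongrightarrow> norm (zeta_approx K s n - zeta s)"
      using assms by (intro tendsto_intros zeta_approx_tendsto_zeta) auto
    then show "norm (zeta_approx K s n - zeta s)
        \<le> A * (\<Sum>i. real i powr - (q - r)) * real n powr - r"
      by (rule tendsto_upperbound[OF _ eventually_sequentiallyI[OF le]]) auto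
  qed
qed

section \<open>Smooth functions times a singular power\<close>

text \<open>
  A jet is a smooth function on \<open>{0..x}\<close> recorded together with all its derivatives, which are
  one-sided at the endpoints. Carrying the derivatives along keeps sums, monomials and Taylor
  remainders free of the operator that computes a derivative.
\<close>
definition is_jet :: "real \<Rightarrow> (nat \<Rightarrow> real \<Rightarrow> real) \<Rightarrow> bool" where
  "is_jet x \<phi> \<longleftrightarrow>
     (\<forall>k. \<forall>t\<in>{0..x}. (\<phi> k has_real_derivative \<phi> (Suc k) t) (at t within {0..x}))"

lemma is_jetD:
  "is_jet x \<phi> \<Longrightarrow> t \<in> {0..x} \<Longrightarrow> (\<phi> k has_real_derivative \<phi> (Suc k) t) (at t within {0..x})"
  by (simp add: is_jet_def)

lemma is_jet_continuous: "is_jet x \<phi> \<Longrightarrow> continuous_on {0..x} (\<phi> k)"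
  unfolding continuous_on_eq_continuous_within using DERIV_continuous is_jetD by blast

lemma is_jet_combination:
  assumes "is_jet x \<phi>" "\<And>m. m \<in> A \<Longrightarrow> is_jet x (\<psi> m)"
  shows "is_jet x (\<lambda>k t. \<phi> k t - (\<Sum>m\<in>A. c m * \<psi> m k t))"
  unfolding is_jet_def[of x "\<lambda>k t. \<phi> k t - (\<Sum>m\<in>A. c m * \<psi> m k t)"]
  by (intro allI ballI DERIV_diff DERIV_sum DERIV_cmult is_jetD assms)

text \<open>
  The \<open>j\<close>-th derivative of \<open>t powr - (1 + \<alpha>)\<close>.
\<close>
definition sing_power :: "real \<Rightarrow> nat \<Rightarrow> real \<Rightarrow> real" where
  "sing_power \<alpha> j t = (-1) ^ j * pochhammer (1 + \<alpha>) j * t powr (- (1 + \<alpha>) - real j)"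

lemma sing_power_deriv:
  assumes "t > 0"
  shows "(sing_power \<alpha> j has_real_derivative sing_power \<alpha> (Suc j) t) (at t within A)"
  unfolding sing_power_def using assms
  by (auto intro!: derivative_eq_intros simp: pochhammer_Suc algebra_simps)

text \<open>
  For \<open>k \<ge> 1\<close> this is the derivative of order \<open>k - 1\<close> of \<open>t powr - (1 + \<alpha>) * \<phi> 0 t\<close>,
  written out by the Leibniz rule. The entry for \<open>k = 0\<close> is an antiderivative of that function on
  \<open>{0<..x}\<close>: formal integration by parts, with the divergent boundary term at the origin dropped.
  It is the finite part of the divergent integral over \<open>{0..t}\<close>, and this choice of the constant
  of integration makes \<open>sing_chain\<close> linear in \<open>\<phi>\<close> and homogeneous on monomials.
\<close>
primrec sing_chain :: "real \<Rightarrow> (nat \<Rightarrow> real \<Rightarrow> real) \<Rightarrow> nat \<Rightarrow> real \<Rightarrow> real" where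
  "sing_chain \<alpha> \<phi> 0 t =
     (integral {0..t} (\<lambda>\<tau>. \<tau> powr (- \<alpha>) * \<phi> 1 \<tau>) - t powr (- \<alpha>) * \<phi> 0 t) / \<alpha>"
| "sing_chain \<alpha> \<phi> (Suc k) t = (\<Sum>j\<le>k. real (k choose j) * sing_power \<alpha> j t * \<phi> (k - j) t)"

lemma integrable_powr_mult:
  fixes g :: "real \<Rightarrow> real"
  assumes "\<alpha> < 1" "continuous_on {0..x} g" "x \<ge> 0"
  shows "(\<lambda>\<tau>. \<tau> powr (- \<alpha>) * g \<tau>) integrable_on {0..x}"
proof -
  have "(\<lambda>\<tau>. g \<tau> * \<tau> powr (- \<alpha>)) absolutely_integrable_on {0..x}"
  proof (rule absolutely_integrable_bounded_measurable_product_real)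
    show "g \<in> borel_measurable (lebesgue_on {0..x})"
      using assms by (intro continuous_imp_measurable_on_sets_lebesgue) auto
    show "bounded (g ` {0..x})"
      using assms by (intro compact_imp_bounded compact_continuous_image) auto
    show "(\<lambda>\<tau>. \<tau> powr (- \<alpha>)) absolutely_integrable_on {0..x}"
      using assms by (intro nonnegative_absolutely_integrable_1 integrable_on_powr_from_0) auto
  qed auto
  then show ?thesis
    by (simp add: set_lebesgue_integral_eq_integral mult.commute)
qed

lemma sing_chain_deriv:
  assumes "0 < \<alpha>" "\<alpha> < 1" "is_jet x \<phi>" "t \<in> {0<..x}"
  shows "(sing_chain \<alpha> \<phi> k has_real_derivative sing_chain \<alpha> \<phi> (Suc k) t) (at t within {0..x})"
proof (cases k)
  case 0
  have t: "t \<in> {0..x}" "t > 0" using assms by auto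
  note d = is_jetD[OF assms(3) t(1)]
  have "((\<lambda>u. integral {0..u} (\<lambda>\<tau>. \<tau> powr (- \<alpha>) * \<phi> 1 \<tau>))
      has_vector_derivative t powr (- \<alpha>) * \<phi> 1 t) (at t within ({0..x} - {}))"
  proof (rule integral_has_vector_derivative_continuous_at)
    show "(\<lambda>\<tau>. \<tau> powr (- \<alpha>) * \<phi> 1 \<tau>) integrable_on {0..x}"
      using assms is_jet_continuous by (intro integrable_powr_mult) auto
    show "continuous (at t within {0..x} - {}) (\<lambda>\<tau>. \<tau> powr (- \<alpha>) * \<phi> 1 \<tau>)"
      using DERIV_continuous[OF d] t unfolding continuous_within Diff_empty
      by (intro tendsto_mult tendsto_powr tendsto_ident_at tendsto_const) auto
  qed (use t in auto)
  then have "((\<lambda>u. integral {0..u} (\<lambda>\<tau>. \<tau> powr (- \<alpha>) * \<phi> 1 \<tau>))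
      has_real_derivative t powr (- \<alpha>) * \<phi> 1 t) (at t within {0..x})"
    by (simp add: has_real_derivative_iff_has_vector_derivative)
  then have "(sing_chain \<alpha> \<phi> 0 has_real_derivative
      (t powr (- \<alpha>) * \<phi> 1 t -
        (- \<alpha> * t powr (- \<alpha> - 1) * \<phi> 0 t + \<phi> (Suc 0) t * t powr (- \<alpha>))) / \<alpha>) (at t within {0..x})"
    unfolding sing_chain.simps
    by (intro DERIV_cdivide DERIV_diff DERIV_mult d)
      (use t in \<open>auto intro!: derivative_eq_intros\<close>)
  also have "(t powr (- \<alpha>) * \<phi> 1 t -
        (- \<alpha> * t powr (- \<alpha> - 1) * \<phi> 0 t + \<phi> (Suc 0) t * t powr (- \<alpha>))) / \<alpha>
      = sing_chain \<alpha> \<phi> (Suc 0) t"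
    using assms by (simp add: sing_power_def minus_diff_commute)
  finally show ?thesis unfolding 0 .
next
  case (Suc k')
  have t: "t \<in> {0..x}" "t > 0" using assms by auto
  define F where "F = (\<lambda>i j. sing_power \<alpha> i t * \<phi> j t)"
  have "(sing_chain \<alpha> \<phi> (Suc k') has_real_derivative
      (\<Sum>j\<le>k'. real (k' choose j) * (F (Suc j) (k' - j) + F j (Suc (k' - j))))) (at t within {0..x})"
    unfolding sing_chain.simps F_def mult.assoc
    by (intro DERIV_sum DERIV_cmult)
      (rule DERIV_cong[OF DERIV_mult[OF sing_power_deriv[OF t(2)] is_jetD[OF assms(3) t(1)]]],
        simp add: algebra_simps)
  also have "(\<Sum>j\<le>k'. real (k' choose j) * (F (Suc j) (k' - j) + F j (Suc (k' - j))))
      = (\<Sum>j\<le>k'. real (k' choose j) * F (Suc j) (k' - j))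
        + (\<Sum>j\<le>Suc k'. real (k' choose j) * F j (Suc k' - j))"
    by (simp add: distrib_left sum.distrib Suc_diff_le)
  also have "\<dots> = F 0 (Suc k') + (\<Sum>j\<le>k'. real (Suc k' choose Suc j) * F (Suc j) (k' - j))"
    unfolding sum.atMost_Suc_shift by (simp add: distrib_right sum.distrib)
  also have "\<dots> = (\<Sum>j\<le>Suc k'. real (Suc k' choose j) * F j (Suc k' - j))"
    unfolding sum.atMost_Suc_shift by simp
  finally show ?thesis unfolding Suc sing_chain.simps F_def mult.assoc .
qed

text \<open>
  Linearity, in the form needed to subtract a Taylor polynomial.
\<close>
lemma sing_chain_combination:
  assumes "\<alpha> < 1" "is_jet x \<phi>" "\<And>m. m \<in> A \<Longrightarrow> is_jet x (\<psi> m)" "finite A" "t \<in> {0..x}"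
  shows "sing_chain \<alpha> (\<lambda>k t. \<phi> k t - (\<Sum>m\<in>A. c m * \<psi> m k t)) k t
    = sing_chain \<alpha> \<phi> k t - (\<Sum>m\<in>A. c m * sing_chain \<alpha> (\<psi> m) k t)"
proof (cases k)
  case 0
  have int: "(\<lambda>\<tau>. \<tau> powr (- \<alpha>) * f 1 \<tau>) integrable_on {0..t}" if "is_jet x f" for f
    using is_jet_continuous[OF that, of 1] assms
    by (intro integrable_powr_mult) (auto elim: continuous_on_subset)
  have "integral {0..t} (\<lambda>\<tau>. \<tau> powr (- \<alpha>) * (\<phi> 1 \<tau> - (\<Sum>m\<in>A. c m * \<psi> m 1 \<tau>)))
      = integral {0..t} (\<lambda>\<tau>. \<tau> powr (- \<alpha>) * \<phi> 1 \<tau> - (\<Sum>m\<in>A. c m * (\<tau> powr (- \<alpha>) * \<psi> m 1 \<tau>)))"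
    by (simp add: right_diff_distrib sum_distrib_left mult.left_commute)
  also have "\<dots> = integral {0..t} (\<lambda>\<tau>. \<tau> powr (- \<alpha>) * \<phi> 1 \<tau>)
      - (\<Sum>m\<in>A. c m * integral {0..t} (\<lambda>\<tau>. \<tau> powr (- \<alpha>) * \<psi> m 1 \<tau>))"
    using assms int
    by (simp add: integral_diff integral_sum integrable_sum integrable_on_mult_right)
  finally show ?thesis
    using 0 by (simp add: right_diff_distrib sum_distrib_left mult.left_commute
        sum_subtractf diff_divide_distrib sum_divide_distrib)
next
  case (Suc k')
  have "(\<Sum>j\<le>k'. real (k' choose j) * sing_power \<alpha> j t * (\<Sum>m\<in>A. c m * \<psi> m (k' - j) t))
      = (\<Sum>m\<in>A. c m * (\<Sum>j\<le>k'. real (k' choose j) * sing_power \<alpha> j t * \<psi> m (k' - j) t))"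
    unfolding sum_distrib_left by (subst sum.swap) (intro sum.cong refl, simp)
  then show ?thesis
    using Suc by (simp add: right_diff_distrib sum_subtractf)
qed

text \<open>
  The jet of \<open>t ^ m\<close>. For \<open>k > m\<close> the product has a zero factor, so the truncated exponent
  \<open>m - k\<close> does no harm.
\<close>
definition monomial_jet :: "nat \<Rightarrow> nat \<Rightarrow> real \<Rightarrow> real" where
  "monomial_jet m k t = (\<Prod>j<k. real m - real j) * t ^ (m - k)"

lemma monomial_jet_coeff:
  "k \<le> m \<Longrightarrow> (\<Prod>j<k. real m - real j) * fact (m - k) = fact m"
proof (induction k)
  case (Suc k)
  then have "m - k = Suc (m - Suc k)" by simp
  then have "fact (m - k) = (real m - real k) * fact (m - Suc k)"
    using Suc.prems by (simp add: of_nat_diff algebra_simps)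
  with Suc show ?case by simp
qed simp

lemma monomial_jet_eq_0: "m < k \<Longrightarrow> monomial_jet m k t = 0"
  by (auto simp: monomial_jet_def)

lemma is_jet_monomial: "is_jet x (monomial_jet m)"
  unfolding is_jet_def
proof (intro allI ballI)
  fix k t
  show "(monomial_jet m k has_real_derivative monomial_jet m (Suc k) t) (at t within {0..x})"
  proof (cases "k < m")
    case True
    then show ?thesis unfolding monomial_jet_def
      by (auto intro!: derivative_eq_intros simp: of_nat_diff)
  next
    case False
    then have "monomial_jet m k = (\<lambda>t. \<Prod>j<k. real m - real j)"
      by (auto simp: monomial_jet_def)
    with monomial_jet_eq_0[of m "Suc k"] False show ?thesis by simp
  qed
qed

text \<open>
  For \<open>\<phi> = t ^ m\<close> the integrand is \<open>t powr - s\<close> with \<open>s = 1 + \<alpha> - m\<close>. Once the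
  antiderivatives agree (this is where the finite part matters), all derivatives agree because they
  are unique; expanding the Leibniz sums is avoided.
\<close>
lemma sing_chain_monomial:
  assumes "0 < \<alpha>" "\<alpha> < 1" "t > 0"
  shows "of_real (sing_chain \<alpha> (monomial_jet m) k t) = power_chain (of_real (1 + \<alpha> - real m)) k t"
  using \<open>t > 0\<close>
proof (induction k arbitrary: t)
  case 0
  have ne: "real m \<noteq> \<alpha>" using assms by (cases m) auto
  \<comment> \<open>For \<open>m = 0\<close> both sides are \<open>0\<close>, and the boundary term alone gives the antiderivative.\<close>
  have int: "integral {0..t} (\<lambda>\<tau>. \<tau> powr (- \<alpha>) * monomial_jet m 1 \<tau>)
      = real m * t powr (real m - \<alpha>) / (real m - \<alpha>)"
  proof (cases m)
    case (Suc m')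
    have "((\<lambda>\<tau>. real m * \<tau> powr (real m' - \<alpha>)) has_integral
        real m * (t powr (real m' - \<alpha> + 1) / (real m' - \<alpha> + 1))) {0..t}"
      using assms 0 by (intro has_integral_mult_right has_integral_powr_from_0) auto
    also have "?this \<longleftrightarrow> ((\<lambda>\<tau>. \<tau> powr (- \<alpha>) * monomial_jet m 1 \<tau>) has_integral
        real m * (t powr (real m' - \<alpha> + 1) / (real m' - \<alpha> + 1))) {0..t}"
    proof (rule has_integral_cong)
      fix \<tau> assume "\<tau> \<in> {0..t}"
      then show "real m * \<tau> powr (real m' - \<alpha>) = \<tau> powr (- \<alpha>) * monomial_jet m 1 \<tau>"
        by (cases "\<tau> = 0")
          (simp_all add: monomial_jet_def Suc powr_diff powr_minus powr_realpow field_simps)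
    qed
    finally show ?thesis using Suc by (simp add: integral_unique algebra_simps)
  qed (simp add: monomial_jet_def)
  have "sing_chain \<alpha> (monomial_jet m) 0 t
      = (real m * t powr (real m - \<alpha>) / (real m - \<alpha>) - t powr (real m - \<alpha>)) / \<alpha>"
    using 0 unfolding sing_chain.simps int
    by (simp add: monomial_jet_def powr_diff powr_minus powr_realpow field_simps)
  also have "\<dots> = t powr (real m - \<alpha>) / (real m - \<alpha>)"
    using ne assms by (simp add: field_simps)
  finally have "of_real (sing_chain \<alpha> (monomial_jet m) 0 t)
      = complex_of_real (t powr (real m - \<alpha>)) / of_real (real m - \<alpha>)" by simp
  also have "\<dots> = power_chain (of_real (1 + \<alpha> - real m)) 0 t"
    using 0 powr_of_real[of t "real m - \<alpha>"]
    by (simp add: power_chain_def power_coeff_def)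
  finally show ?case .
next
  case (Suc k)
  define s where "s = complex_of_real (1 + \<alpha> - real m)"
  \<comment> \<open>The induction hypothesis holds only for positive arguments, so derivatives are compared on an
    interval around \<open>t\<close> that avoids \<open>0\<close>.\<close>
  have t: "t \<in> {0<..2*t}" "t / 2 < 2 * t" "t \<in> cbox (t/2) (2*t)" using Suc.prems by auto
  have "(sing_chain \<alpha> (monomial_jet m) k has_vector_derivative
      sing_chain \<alpha> (monomial_jet m) (Suc k) t) (at t within {0..2*t})"
    using sing_chain_deriv[OF assms(1,2) is_jet_monomial t(1)]
    by (simp add: has_real_derivative_iff_has_vector_derivative)
  then have "(sing_chain \<alpha> (monomial_jet m) k has_vector_derivative
      sing_chain \<alpha> (monomial_jet m) (Suc k) t) (at t within cbox (t/2) (2*t))"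
    by (rule has_vector_derivative_within_subset) (use t in auto)
  then have "((\<lambda>t. complex_of_real (sing_chain \<alpha> (monomial_jet m) k t)) has_vector_derivative
      of_real (sing_chain \<alpha> (monomial_jet m) (Suc k) t)) (at t within cbox (t/2) (2*t))"
    by (rule bounded_linear.has_vector_derivative[OF bounded_linear_of_real])
  moreover have "((\<lambda>t. complex_of_real (sing_chain \<alpha> (monomial_jet m) k t)) has_vector_derivative
      power_chain s (Suc k) t) (at t within cbox (t/2) (2*t))"
    by (rule has_vector_derivative_transform[OF t(3) _ power_chain_deriv[OF Suc.prems]])
      (use Suc in \<open>auto simp: s_def\<close>)
  ultimately show ?case
    unfolding s_def by (rule vector_derivative_unique_within_closed_interval[OF t(2,3)])
qed

text \<open>
  The derivatives of a Taylor remainder are the Taylor remainders of the derivatives, so each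
  differentiation costs one power of \<open>t\<close>.
\<close>
lemma taylor_jet_bound:
  assumes "is_jet x \<phi>" "k \<le> M" "t \<in> {0..x}"
    and bound: "\<And>t. t \<in> {0..x} \<Longrightarrow> \<bar>\<phi> (Suc M) t\<bar> \<le> B"
  shows "\<bar>\<phi> k t - (\<Sum>m\<le>M. \<phi> m 0 / fact m * monomial_jet m k t)\<bar> \<le> B * t ^ (Suc M - k)"
proof -
  have "norm (\<phi> (k + 0) (0 + t) - (\<Sum>j<Suc M - k. (t ^ j / fact j) *\<^sub>R \<phi> (k + j) 0)) \<le> B * t ^ (Suc M - k)"
  proof (rule taylor_remainder_bound[where D = "\<lambda>j. \<phi> (k + j)"])
    fix j u assume u: "u \<in> {0..0+t}"
    have "(\<phi> (k + j) has_vector_derivative \<phi> (Suc (k + j)) u) (at u within {0..x})"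
      using is_jetD[OF assms(1), of u "k + j"] u assms(3)
      by (simp add: has_real_derivative_iff_has_vector_derivative)
    then show "(\<phi> (k + j) has_vector_derivative \<phi> (k + Suc j) u) (at u within {0..0+t})"
      using assms(3) by (auto elim!: has_vector_derivative_within_subset)
  qed (use assms in auto)
  also have "(\<Sum>j<Suc M - k. (t ^ j / fact j) *\<^sub>R \<phi> (k + j) 0)
      = (\<Sum>m\<in>{k..M}. \<phi> m 0 / fact m * monomial_jet m k t)"
  proof (rule sum.reindex_bij_witness[of _ "\<lambda>m. m - k" "\<lambda>j. k + j"])
    fix j assume "j \<in> {..<Suc M - k}"
    have "(\<Prod>i<k. real (k + j) - real i) = fact (k + j) / fact j"
      using monomial_jet_coeff[of k "k + j"] by (simp add: field_simps)
    then show "\<phi> (k + j) 0 / fact (k + j) * monomial_jet (k + j) k t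
        = (t ^ j / fact j) *\<^sub>R \<phi> (k + j) 0"
      by (simp add: monomial_jet_def)
  qed (use assms in auto)
  also have "\<dots> = (\<Sum>m\<le>M. \<phi> m 0 / fact m * monomial_jet m k t)"
    by (rule sum.mono_neutral_left) (auto simp: monomial_jet_eq_0)
  finally show ?thesis by simp
qed

text \<open>
  If \<open>\<rho>\<close> vanishes to order \<open>M + 1\<close> at the origin, each Leibniz term of
  \<open>t powr - (1 + \<alpha>) * \<rho> 0 t\<close> has the same total exponent, and the singularity is reduced
  accordingly.
\<close>
lemma sing_chain_remainder_bound:
  assumes "0 < \<alpha>" "\<alpha> < 1" "is_jet x \<rho>" "M \<ge> 1" "k \<le> Suc M" "B \<ge> 0"
    and \<rho>: "\<And>k t. k \<le> M \<Longrightarrow> t \<in> {0..x} \<Longrightarrow> \<bar>\<rho> k t\<bar> \<le> B * t ^ (Suc M - k)"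
  obtains C where "C \<ge> 0"
    "\<And>t. t \<in> {0<..x} \<Longrightarrow> \<bar>sing_chain \<alpha> \<rho> k t\<bar> \<le> C * t powr (real (Suc M) - \<alpha> - real k)"
proof (cases k)
  case 0
  show ?thesis
  proof (rule that)
    show "0 \<le> 2 * B / \<alpha>" using assms by simp
    fix t assume t: "t \<in> {0<..x}"
    have le: "\<bar>\<tau> powr (- \<alpha>) * \<rho> 1 \<tau>\<bar> \<le> B * t powr (real M - \<alpha>)" if "\<tau> \<in> {0..t}" for \<tau>
    proof (cases "\<tau> = 0")
      case False
      have "\<bar>\<tau> powr (- \<alpha>) * \<rho> 1 \<tau>\<bar> \<le> \<tau> powr (- \<alpha>) * (B * \<tau> ^ M)"
        unfolding abs_mult using \<rho>[of 1 \<tau>] that t assms by (simp add: mult_left_mono)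
      also have "\<dots> = B * \<tau> powr (real M - \<alpha>)"
        using that False by (simp add: powr_diff powr_minus powr_realpow field_simps)
      also have "\<dots> \<le> B * t powr (real M - \<alpha>)"
        using that assms by (intro mult_left_mono powr_mono2) auto
      finally show ?thesis .
    qed (use assms in auto)
    have "continuous_on {0..t} (\<rho> 1)"
      by (rule continuous_on_subset[OF is_jet_continuous[OF assms(3)]]) (use t in auto)
    then have "(\<lambda>\<tau>. \<tau> powr (- \<alpha>) * \<rho> 1 \<tau>) integrable_on {0..t}"
      using assms t by (intro integrable_powr_mult) auto
    then have "norm (integral (cbox 0 t) (\<lambda>\<tau>. \<tau> powr (- \<alpha>) * \<rho> 1 \<tau>))
        \<le> (B * t powr (real M - \<alpha>)) * measure lborel (cbox 0 t)"
      using le assms by (intro integrable_bound) auto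
    moreover have "t * t powr (real M - \<alpha>) = t powr (real (Suc M) - \<alpha>)"
      using t by (simp add: powr_mult_base algebra_simps)
    ultimately have 1: "\<bar>integral {0..t} (\<lambda>\<tau>. \<tau> powr (- \<alpha>) * \<rho> 1 \<tau>)\<bar> \<le> B * t powr (real (Suc M) - \<alpha>)"
      using t by (simp add: mult_ac)
    have "\<bar>t powr (- \<alpha>) * \<rho> 0 t\<bar> \<le> t powr (- \<alpha>) * (B * t ^ Suc M)"
      unfolding abs_mult using \<rho>[of 0 t] t by (simp add: mult_left_mono)
    also have "\<dots> = B * t powr (real (Suc M) - \<alpha>)"
      using t powr_realpow[of t "Suc M"] by (simp add: powr_diff powr_minus field_simps)
    finally have 2: "\<bar>t powr (- \<alpha>) * \<rho> 0 t\<bar> \<le> B * t powr (real (Suc M) - \<alpha>)" .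
    have "\<bar>sing_chain \<alpha> \<rho> k t\<bar> = \<bar>integral {0..t} (\<lambda>\<tau>. \<tau> powr (- \<alpha>) * \<rho> 1 \<tau>) - t powr (- \<alpha>) * \<rho> 0 t\<bar> / \<alpha>"
      using 0 assms by (simp add: abs_divide)
    also have "\<dots> \<le> (B * t powr (real (Suc M) - \<alpha>) + B * t powr (real (Suc M) - \<alpha>)) / \<alpha>"
      using 1 2 assms by (intro divide_right_mono) linarith+
    finally show "\<bar>sing_chain \<alpha> \<rho> k t\<bar> \<le> 2 * B / \<alpha> * t powr (real (Suc M) - \<alpha> - real k)"
      using 0 by simp
  qed
next
  case (Suc k')
  define C where "C = (\<Sum>j\<le>k'. real (k' choose j) * pochhammer (1 + \<alpha>) j * B)"
  have poch: "pochhammer (1 + \<alpha>) j \<ge> 0" for j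
    using assms by (intro pochhammer_nonneg) auto
  show ?thesis
  proof (rule that)
    show "0 \<le> C" unfolding C_def using poch assms by (intro sum_nonneg) auto
    fix t assume t: "t \<in> {0<..x}"
    have "\<bar>sing_chain \<alpha> \<rho> k t\<bar>
        \<le> (\<Sum>j\<le>k'. \<bar>real (k' choose j) * sing_power \<alpha> j t * \<rho> (k' - j) t\<bar>)"
      unfolding Suc sing_chain.simps by (rule sum_abs)
    also have "\<dots> \<le> (\<Sum>j\<le>k'. real (k' choose j) * pochhammer (1 + \<alpha>) j * B
        * t powr (real (Suc M) - \<alpha> - real k))"
    proof (rule sum_mono)
      fix j assume j: "j \<in> {..k'}"
      have "\<bar>real (k' choose j) * sing_power \<alpha> j t * \<rho> (k' - j) t\<bar>
          = real (k' choose j) * pochhammer (1 + \<alpha>) j * t powr (- (1 + \<alpha>) - real j) * \<bar>\<rho> (k' - j) t\<bar>"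
        using poch[of j] by (simp add: sing_power_def abs_mult power_abs)
      also have "\<dots> \<le> real (k' choose j) * pochhammer (1 + \<alpha>) j * t powr (- (1 + \<alpha>) - real j)
          * (B * t powr real (Suc M - (k' - j)))"
      proof (rule mult_left_mono)
        have "\<bar>\<rho> (k' - j) t\<bar> \<le> B * t ^ (Suc M - (k' - j))"
          by (rule \<rho>) (use t assms Suc in auto)
        then show "\<bar>\<rho> (k' - j) t\<bar> \<le> B * t powr real (Suc M - (k' - j))"
          using t by (subst powr_realpow) auto
      qed (use poch[of j] in auto)
      also have "\<dots> = real (k' choose j) * pochhammer (1 + \<alpha>) j * B
          * t powr (- (1 + \<alpha>) - real j + real (Suc M - (k' - j)))"
        by (simp only: powr_add mult_ac)
      also have "- (1 + \<alpha>) - real j + real (Suc M - (k' - j)) = real (Suc M) - \<alpha> - real k"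
        using j assms Suc by (simp add: of_nat_diff)
      finally show "\<bar>real (k' choose j) * sing_power \<alpha> j t * \<rho> (k' - j) t\<bar>
          \<le> real (k' choose j) * pochhammer (1 + \<alpha>) j * B * t powr (real (Suc M) - \<alpha> - real k)" .
    qed
    finally show "\<bar>sing_chain \<alpha> \<rho> k t\<bar> \<le> C * t powr (real (Suc M) - \<alpha> - real k)"
      by (simp add: C_def sum_distrib_right)
  qed
qed

section \<open>Euler-Maclaurin expansion at a power singularity\<close>

text \<open>
  The sum of \<open>h * g (i * h)\<close> over the interior nodes of \<open>{0..x}\<close>, for step \<open>h = x / n\<close> and
  \<open>g t = t powr - (1 + \<alpha>) * \<phi> 0 t\<close>, minus the Euler-Maclaurin terms at the regular endpoint
  \<open>x\<close>, the finite-part integral being the term \<open>k = 0\<close>. What remains is produced by the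
  singularity at the origin, and it is linear in \<open>\<phi>\<close>.
\<close>
definition em_defect ::
  "real \<Rightarrow> real \<Rightarrow> nat \<Rightarrow> (nat \<Rightarrow> real \<Rightarrow> real) \<Rightarrow> nat \<Rightarrow> real" where
  "em_defect \<alpha> x K \<phi> n =
     (\<Sum>i=1..<n. (x / real n) * sing_chain \<alpha> \<phi> 1 (real i * (x / real n)))
     - (\<Sum>k\<le>K. bernoulli k / fact k * (x / real n) ^ k * sing_chain \<alpha> \<phi> k x)"

lemma em_defect_combination:
  assumes "\<alpha> < 1" "x > 0" "is_jet x \<phi>" "\<And>m. m \<in> A \<Longrightarrow> is_jet x (\<psi> m)" "finite A"
  shows "em_defect \<alpha> x K (\<lambda>k t. \<phi> k t - (\<Sum>m\<in>A. c m * \<psi> m k t)) n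
    = em_defect \<alpha> x K \<phi> n - (\<Sum>m\<in>A. c m * em_defect \<alpha> x K (\<psi> m) n)"
proof -
  have lin: "sing_chain \<alpha> (\<lambda>k t. \<phi> k t - (\<Sum>m\<in>A. c m * \<psi> m k t)) k t
      = sing_chain \<alpha> \<phi> k t - (\<Sum>m\<in>A. c m * sing_chain \<alpha> (\<psi> m) k t)" if "t \<in> {0..x}" for k t
    using assms that by (intro sing_chain_combination) auto
  have mem: "real i * (x / real n) \<in> {0..x}" if "i \<in> {1..<n}" for i
    using that assms by (auto simp: field_simps)
  define h where "h = x / real n"
  have *: "(\<Sum>i=1..<n. h * (\<Sum>m\<in>A. c m * sing_chain \<alpha> (\<psi> m) 1 (real i * h)))
      = (\<Sum>m\<in>A. c m * (\<Sum>i=1..<n. h * sing_chain \<alpha> (\<psi> m) 1 (real i * h)))"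
    unfolding sum_distrib_left by (subst sum.swap) (simp add: mult.left_commute)
  have **: "(\<Sum>k\<le>K. bernoulli k / fact k * h ^ k * (\<Sum>m\<in>A. c m * sing_chain \<alpha> (\<psi> m) k x))
      = (\<Sum>m\<in>A. c m * (\<Sum>k\<le>K. bernoulli k / fact k * h ^ k * sing_chain \<alpha> (\<psi> m) k x))"
    unfolding sum_distrib_left by (subst sum.swap) (simp add: mult.left_commute)
  have "(\<Sum>i=1..<n. h * sing_chain \<alpha> (\<lambda>k t. \<phi> k t - (\<Sum>m\<in>A. c m * \<psi> m k t)) 1 (real i * h))
      = (\<Sum>i=1..<n. h * sing_chain \<alpha> \<phi> 1 (real i * h)
          - h * (\<Sum>m\<in>A. c m * sing_chain \<alpha> (\<psi> m) 1 (real i * h)))"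
    unfolding h_def by (intro sum.cong refl) (simp only: lin[OF mem] right_diff_distrib)
  moreover have "sing_chain \<alpha> (\<lambda>k t. \<phi> k t - (\<Sum>m\<in>A. c m * \<psi> m k t)) k x
      = sing_chain \<alpha> \<phi> k x - (\<Sum>m\<in>A. c m * sing_chain \<alpha> (\<psi> m) k x)" for k
    using assms by (intro lin) auto
  ultimately show ?thesis
    unfolding em_defect_def h_def[symmetric]
    by (simp only: * ** sum_subtractf right_diff_distrib)
qed

lemma power_chain_scale:
  assumes "h > 0" "t \<ge> 0"
  shows "of_real h ^ k * power_chain s k (t * h) = of_real h powr (1 - s) * power_chain s k t"
proof -
  have "of_real (t * h) powr (1 - s - of_nat k)
      = of_real t powr (1 - s - of_nat k) * of_real h powr (1 - s - of_nat k)"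
    unfolding of_real_mult using assms by (intro powr_times_real) auto
  moreover have "of_real h ^ k * of_real h powr (1 - s - of_nat k) = of_real h powr (1 - s)"
    using assms by (simp add: powr_diff powr_nat')
  ultimately show ?thesis
    by (simp add: power_chain_def mult_ac)
qed

text \<open>
  By homogeneity the step size can be scaled out of a pure power, and a sum over integers is left.
\<close>
lemma em_defect_monomial:
  assumes "0 < \<alpha>" "\<alpha> < 1" "x > 0" "n \<ge> 1"
  shows "em_defect \<alpha> x K (monomial_jet m) n
    = (x / real n) powr (real m - \<alpha>) * Re (zeta_approx K (of_real (1 + \<alpha> - real m)) n)"
proof -
  define h where "h = x / real n"
  define s where "s = complex_of_real (1 + \<alpha> - real m)"
  have h: "h > 0" "x = real n * h" using assms by (simp_all add: h_def)
  have ne: "s \<noteq> 1"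
    unfolding s_def of_real_eq_1_iff using assms by (cases m) auto
  have chain: "complex_of_real (sing_chain \<alpha> (monomial_jet m) k t) = power_chain s k t"
    if "t > 0" for k t
    using sing_chain_monomial[OF assms(1,2) that] by (simp add: s_def)
  have "complex_of_real (em_defect \<alpha> x K (monomial_jet m) n)
      = (\<Sum>i=1..<n. of_real h ^ 1 * power_chain s 1 (real i * h))
        - (\<Sum>k\<le>K. of_real (bernoulli k / fact k) * (of_real h ^ k * power_chain s k (real n * h)))"
    using h assms chain unfolding em_defect_def h_def[symmetric]
    by (simp add: mult.assoc del: sing_chain.simps)
  also have "\<dots> = of_real h powr (1 - s) * zeta_approx K s n"
    using h ne unfolding zeta_approx_def
    by (simp only: power_chain_scale of_nat_0_le_iff)
      (simp add: power_chain_1 sum_distrib_left right_diff_distrib mult_ac)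
  also have "of_real h powr (1 - s) = complex_of_real (h powr (real m - \<alpha>))"
    using h by (simp add: s_def flip: powr_of_real)
  finally have "Re (complex_of_real (em_defect \<alpha> x K (monomial_jet m) n))
      = Re (complex_of_real (h powr (real m - \<alpha>)) * zeta_approx K s n)" by simp
  then show ?thesis by (simp add: h_def s_def)
qed

text \<open>
  The zeta values of the expansion arise here, as limits of \<open>zeta_approx\<close>. The
  condition \<open>m \<le> K\<close> puts \<open>1 + \<alpha> - m\<close> inside the half-plane of convergence.
\<close>
lemma em_defect_monomial_bigo:
  assumes "0 < \<alpha>" "\<alpha> < 1" "x > 0" "K \<ge> 1" "m \<le> K"
  shows "(\<lambda>n. em_defect \<alpha> x K (monomial_jet m) n
      - Re (zeta (of_real (1 + \<alpha> - real m))) * (x / real n) powr (real m - \<alpha>))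
    \<in> O(\<lambda>n. (x / real n) powr (real K - \<alpha>))"
proof -
  define s where "s = complex_of_real (1 + \<alpha> - real m)"
  have ne: "s \<noteq> 1"
    unfolding s_def of_real_eq_1_iff using assms by (cases m) auto
  obtain C where C: "\<And>n. n \<ge> 1 \<Longrightarrow>
      norm (zeta_approx K s n - zeta s) \<le> C * real n powr - (real K - real m)"
    using zeta_approx_error[OF \<open>K \<ge> 1\<close> ne, of "real K - real m"] assms by (auto simp: s_def)
  show ?thesis
  proof (rule bigoI[of _ "C * x powr - (real K - real m)"], rule eventually_sequentiallyI[of 1])
    fix n :: nat assume n: "n \<ge> 1"
    define h where "h = x / real n"
    have h: "h > 0" "real n = x / h" using assms n by (simp_all add: h_def)
    have "em_defect \<alpha> x K (monomial_jet m) n - Re (zeta s) * h powr (real m - \<alpha>)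
        = h powr (real m - \<alpha>) * Re (zeta_approx K s n - zeta s)"
      using em_defect_monomial[OF assms(1-3) n, of K m]
      by (simp add: h_def s_def algebra_simps)
    then have "\<bar>em_defect \<alpha> x K (monomial_jet m) n - Re (zeta s) * h powr (real m - \<alpha>)\<bar>
        = h powr (real m - \<alpha>) * \<bar>Re (zeta_approx K s n - zeta s)\<bar>"
      by (simp add: abs_mult)
    also have "\<dots> \<le> h powr (real m - \<alpha>) * (C * real n powr - (real K - real m))"
      using C[OF n] abs_Re_le_cmod[of "zeta_approx K s n - zeta s"]
      by (intro mult_left_mono) auto
    also have "real n powr - (real K - real m) = x powr - (real K - real m) * h powr (real K - real m)"
    proof -
      have "(x / h) powr - r = x powr - r * h powr r" for r
        using h(1) assms(3) by (simp add: powr_divide powr_minus field_simps)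
      then show ?thesis unfolding h(2) .
    qed
    also have "h powr (real m - \<alpha>) * (C * (x powr - (real K - real m) * h powr (real K - real m)))
        = C * x powr - (real K - real m) * h powr ((real m - \<alpha>) + (real K - real m))"
      by (simp only: powr_add mult_ac)
    finally show "norm (em_defect \<alpha> x K (monomial_jet m) n
          - Re (zeta (of_real (1 + \<alpha> - real m))) * (x / real n) powr (real m - \<alpha>))
        \<le> C * x powr - (real K - real m) * norm ((x / real n) powr (real K - \<alpha>))"
      by (simp add: h_def s_def)
  qed
qed

text \<open>
  On \<open>{h..x}\<close> the summed function is smooth, and the Euler-Maclaurin bound applies between the
  nodes \<open>1\<close> and \<open>n\<close>. Its derivative of order \<open>K\<close> is \<open>O(t powr - \<alpha>)\<close>, hence at most a
  multiple of \<open>h powr - \<alpha>\<close> on every cell; \<open>n = x / h\<close> cells of weight \<open>h ^ (K + 1)\<close>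
  contribute \<open>O(h powr (K - \<alpha>))\<close>. The boundary terms at the lower end \<open>h\<close> are even smaller.
\<close>
lemma em_defect_remainder_bigo:
  assumes "0 < \<alpha>" "\<alpha> < 1" "x > 0" "is_jet x \<rho>" "K \<ge> 1" "B \<ge> 0"
    and \<rho>: "\<And>k t. k \<le> K \<Longrightarrow> t \<in> {0..x} \<Longrightarrow> \<bar>\<rho> k t\<bar> \<le> B * t ^ (Suc K - k)"
  shows "em_defect \<alpha> x K \<rho> \<in> O(\<lambda>n. (x / real n) powr (real K - \<alpha>))"
proof -
  have "\<exists>C\<ge>0. \<forall>t\<in>{0<..x}. \<bar>sing_chain \<alpha> \<rho> k t\<bar> \<le> C * t powr (real (Suc K) - \<alpha> - real k)"
    if "k \<le> Suc K" for k
    by (rule sing_chain_remainder_bound[OF assms(1,2,4,5) that assms(6) \<rho>]) auto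
  then obtain C where C: "\<And>k. k \<le> Suc K \<Longrightarrow> C k \<ge> 0" "\<And>k t. k \<le> Suc K \<Longrightarrow> t \<in> {0<..x} \<Longrightarrow>
      \<bar>sing_chain \<alpha> \<rho> k t\<bar> \<le> C k * t powr (real (Suc K) - \<alpha> - real k)"
    by metis
  define C1 where "C1 = (\<Sum>k\<le>K. \<bar>bernoulli k / fact k\<bar>) * x * C (Suc K)"
  define C2 where "C2 = (\<Sum>k\<le>K. \<bar>bernoulli k / fact k\<bar> * C k) * x"
  show ?thesis
  proof (rule bigoI[of _ "C1 + C2"], rule eventually_sequentiallyI[of 1])
    fix n :: nat assume n: "n \<ge> 1"
    define h where "h = x / real n"
    have h: "h > 0" "h \<le> x" "real n * h = x" using assms n by (simp_all add: h_def field_simps)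
    have Kpow: "h ^ K * h powr - \<alpha> = h powr (real K - \<alpha>)"
      using h by (simp add: powr_realpow powr_diff powr_minus_divide)
    define R where "R = (\<Sum>i=1..<n. h *\<^sub>R sing_chain \<alpha> \<rho> 1 (real i * h))
        - (\<Sum>k\<le>K. (bernoulli k / fact k * h ^ k) *\<^sub>R
            (sing_chain \<alpha> \<rho> k (real n * h) - sing_chain \<alpha> \<rho> k (real 1 * h)))"
    have "norm R \<le> (\<Sum>k\<le>K. \<bar>bernoulli k / fact k\<bar>) * h ^ Suc K
        * (\<Sum>i=1..<n. C (Suc K) * h powr - \<alpha>)"
      unfolding R_def
    proof (rule euler_maclaurin_bound)
      fix k t assume t: "t \<in> {real 1 * h..real n * h}"
      have "(sing_chain \<alpha> \<rho> k has_vector_derivative sing_chain \<alpha> \<rho> (Suc k) t) (at t within {0..x})"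
        using sing_chain_deriv[OF assms(1,2,4), of t k] t h
        by (simp add: has_real_derivative_iff_has_vector_derivative)
      then show "(sing_chain \<alpha> \<rho> k has_vector_derivative sing_chain \<alpha> \<rho> (Suc k) t)
          (at t within {real 1 * h..real n * h})"
        by (rule has_vector_derivative_within_subset) (use h in auto)
    next
      fix i t assume i: "1 \<le> i" "i < n" and t: "t \<in> {real i * h..real (Suc i) * h}"
      have "1 * h \<le> real i * h" "real (Suc i) * h \<le> real n * h"
        using i h by (intro mult_right_mono; simp)+
      moreover have "real i * h \<le> t" "t \<le> real (Suc i) * h" using t by auto
      ultimately have "h \<le> t" "t \<le> x" unfolding h(3) by linarith+
      with h have t': "t \<in> {0<..x}" "h \<le> t" by auto
      have "norm (sing_chain \<alpha> \<rho> (Suc K) t) \<le> C (Suc K) * t powr - \<alpha>"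
        using C(2)[of "Suc K" t] t' by simp
      also have "\<dots> \<le> C (Suc K) * h powr - \<alpha>"
        using C(1) t' h assms by (intro mult_left_mono powr_mono2') auto
      finally show "norm (sing_chain \<alpha> \<rho> (Suc K) t) \<le> C (Suc K) * h powr - \<alpha>" .
    qed (use assms n h in auto)
    also have "(\<Sum>i=1..<n. C (Suc K) * h powr - \<alpha>) \<le> real n * (C (Suc K) * h powr - \<alpha>)"
      using C(1)[of "Suc K"] by (auto intro!: mult_right_mono)
    also have "(\<Sum>k\<le>K. \<bar>bernoulli k / fact k\<bar>) * h ^ Suc K * (real n * (C (Suc K) * h powr - \<alpha>))
        = (\<Sum>k\<le>K. \<bar>bernoulli k / fact k\<bar>) * (real n * h) * C (Suc K) * (h ^ K * h powr - \<alpha>)"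
      by (simp only: power_Suc mult_ac)
    also have "\<dots> = C1 * h powr (real K - \<alpha>)"
      unfolding Kpow h(3) C1_def ..
    finally have R: "\<bar>R\<bar> \<le> C1 * h powr (real K - \<alpha>)"
      using h by (simp add: mult_left_mono sum_nonneg)
    have "\<bar>\<Sum>k\<le>K. bernoulli k / fact k * h ^ k * sing_chain \<alpha> \<rho> k h\<bar>
        \<le> (\<Sum>k\<le>K. \<bar>bernoulli k / fact k\<bar> * C k * (h * h powr (real K - \<alpha>)))"
    proof (rule order.trans[OF sum_abs], rule sum_mono)
      fix k assume k: "k \<in> {..K}"
      have "\<bar>bernoulli k / fact k * h ^ k * sing_chain \<alpha> \<rho> k h\<bar>
          \<le> \<bar>bernoulli k / fact k\<bar> * h ^ k * (C k * h powr (real (Suc K) - \<alpha> - real k))"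
        unfolding abs_mult using C(2)[of k h] k h by (intro mult_mono) auto
      also have "\<dots> = \<bar>bernoulli k / fact k\<bar> * C k * h powr (real k + (real (Suc K) - \<alpha> - real k))"
        using h by (simp only: powr_add powr_realpow mult_ac)
      also have "real k + (real (Suc K) - \<alpha> - real k) = 1 + (real K - \<alpha>)" by simp
      also have "h powr (1 + (real K - \<alpha>)) = h * h powr (real K - \<alpha>)"
        using h by (simp add: powr_mult_base)
      finally show "\<bar>bernoulli k / fact k * h ^ k * sing_chain \<alpha> \<rho> k h\<bar>
          \<le> \<bar>bernoulli k / fact k\<bar> * C k * (h * h powr (real K - \<alpha>))" .
    qed
    also have "\<dots> \<le> (\<Sum>k\<le>K. \<bar>bernoulli k / fact k\<bar> * C k * (x * h powr (real K - \<alpha>)))"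
      using C(1) h by (intro sum_mono mult_left_mono mult_right_mono mult_nonneg_nonneg) auto
    also have "\<dots> = C2 * h powr (real K - \<alpha>)"
      by (simp add: C2_def sum_distrib_right mult.assoc)
    finally have first: "\<bar>\<Sum>k\<le>K. bernoulli k / fact k * h ^ k * sing_chain \<alpha> \<rho> k h\<bar>
        \<le> C2 * h powr (real K - \<alpha>)" .
    have "em_defect \<alpha> x K \<rho> n = R - (\<Sum>k\<le>K. bernoulli k / fact k * h ^ k * sing_chain \<alpha> \<rho> k h)"
      unfolding em_defect_def R_def h_def[symmetric] h(3)
      by (simp add: right_diff_distrib sum_subtractf)
    with R first show "norm (em_defect \<alpha> x K \<rho> n) \<le> (C1 + C2) * norm ((x / real n) powr (real K - \<alpha>))"
      by (simp add: h_def[symmetric] distrib_right)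
  qed
qed

text \<open>
  Split \<open>\<phi>\<close> into its Taylor polynomial of degree \<open>K\<close> at the singular point and a remainder. Each
  monomial contributes one zeta value, and the remainder only an error.
\<close>
theorem em_defect_expansion:
  assumes "0 < \<alpha>" "\<alpha> < 1" "x > 0" "is_jet x \<phi>" "K \<ge> 1"
  shows "(\<lambda>n. em_defect \<alpha> x K \<phi> n
      - (\<Sum>m\<le>K. \<phi> m 0 / fact m * (Re (zeta (of_real (1 + \<alpha> - real m)))
          * (x / real n) powr (real m - \<alpha>))))
    \<in> O(\<lambda>n. (x / real n) powr (real K - \<alpha>))"
proof -
  define \<rho> where "\<rho> = (\<lambda>k t. \<phi> k t - (\<Sum>m\<le>K. \<phi> m 0 / fact m * monomial_jet m k t))"
  have "bounded (\<phi> (Suc K) ` {0..x})"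
    using is_jet_continuous[OF assms(4)] by (intro compact_imp_bounded compact_continuous_image) auto
  then obtain B where "\<forall>v\<in>\<phi> (Suc K) ` {0..x}. norm v \<le> B"
    unfolding bounded_iff by blast
  then have B: "\<bar>\<phi> (Suc K) t\<bar> \<le> B" if "t \<in> {0..x}" for t
    using that by auto
  have "B \<ge> 0" using B[of 0] assms by auto
  have "is_jet x \<rho>"
    unfolding \<rho>_def by (intro is_jet_combination is_jet_monomial assms)
  have rem: "em_defect \<alpha> x K \<rho> \<in> O(\<lambda>n. (x / real n) powr (real K - \<alpha>))"
    using assms \<open>B \<ge> 0\<close> \<open>is_jet x \<rho>\<close> taylor_jet_bound[OF assms(4) _ _ B]
    unfolding \<rho>_def by (intro em_defect_remainder_bigo[of _ _ _ _ B])
  have "em_defect \<alpha> x K \<rho> n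
      = em_defect \<alpha> x K \<phi> n - (\<Sum>m\<le>K. \<phi> m 0 / fact m * em_defect \<alpha> x K (monomial_jet m) n)" for n
    unfolding \<rho>_def using assms by (intro em_defect_combination is_jet_monomial) auto
  then have "em_defect \<alpha> x K \<phi> n
      - (\<Sum>m\<le>K. \<phi> m 0 / fact m * (Re (zeta (of_real (1 + \<alpha> - real m)))
          * (x / real n) powr (real m - \<alpha>)))
    = em_defect \<alpha> x K \<rho> n + (\<Sum>m\<le>K. \<phi> m 0 / fact m * (em_defect \<alpha> x K (monomial_jet m) n
        - Re (zeta (of_real (1 + \<alpha> - real m))) * (x / real n) powr (real m - \<alpha>)))" for n
    by (simp add: right_diff_distrib sum_subtractf)
  moreover have "(\<lambda>n. em_defect \<alpha> x K \<rho> n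
      + (\<Sum>m\<le>K. \<phi> m 0 / fact m * (em_defect \<alpha> x K (monomial_jet m) n
        - Re (zeta (of_real (1 + \<alpha> - real m))) * (x / real n) powr (real m - \<alpha>))))
      \<in> O(\<lambda>n. (x / real n) powr (real K - \<alpha>))"
    by (intro sum_in_bigo(1) rem big_sum_in_bigo cmult_in_bigo_iff[THEN iffD2] disjI2
        em_defect_monomial_bigo assms) auto
  ultimately show ?thesis by simp
qed

section \<open>The expansion in terms of the Caputo derivative\<close>

lemma reflected_derivs_is_jet:
  assumes "smooth_on {0..x} y"
  shows "is_jet x (\<lambda>k t. (-1) ^ k * nth_deriv_on {0..x} k y (x - t))"
  unfolding is_jet_def
proof (intro allI ballI)
  fix k t assume t: "t \<in> {0..x}"
  define f where "f = nth_deriv_on {0..x} k y"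
  have "f differentiable (at (x - t) within {0..x})"
    using assms t by (auto simp: smooth_on_def differentiable_on_def f_def)
  then have "(f has_real_derivative nth_deriv_on {0..x} (Suc k) y (x - t)) (at (x - t) within {0..x})"
    by (simp add: has_real_derivative_iff_has_vector_derivative f_def flip: vector_derivative_works)
  then have "(f has_real_derivative nth_deriv_on {0..x} (Suc k) y (x - t))
      (at (x - t) within (\<lambda>t. x - t) ` {0..x})"
    by simp
  then have "((\<lambda>t. f (x - t)) has_real_derivative nth_deriv_on {0..x} (Suc k) y (x - t) * (- 1))
      (at t within {0..x})"
    by (rule DERIV_image_chain[unfolded o_def]) (auto intro!: derivative_eq_intros)
  from DERIV_cmult[OF this, of "(-1) ^ k"]
  show "((\<lambda>t. (-1) ^ k * nth_deriv_on {0..x} k y (x - t)) has_real_derivative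
      (-1) ^ Suc k * nth_deriv_on {0..x} (Suc k) y (x - t)) (at t within {0..x})"
    by (simp add: f_def)
qed

lemma integral_reflect_interval:
  fixes f :: "real \<Rightarrow> real"
  assumes "f integrable_on {0..x}"
  shows "integral {0..x} (\<lambda>t. f (x - t)) = integral {0..x} f"
proof (rule integral_unique)
  have "((\<lambda>t. f (- 1 *\<^sub>R t + x)) has_integral (1 / \<bar>- 1\<bar> ^ DIM(real)) *\<^sub>R integral {0..x} f)
      ((\<lambda>t. (1 / - 1) *\<^sub>R t + - ((1 / - 1) *\<^sub>R x)) ` cbox 0 x)"
    using assms by (intro has_integral_affinity) (auto simp: integrable_integral)
  also have "(\<lambda>t. (1 / - 1) *\<^sub>R t + - ((1 / - 1) *\<^sub>R x)) ` cbox 0 x = {0..x}" by simp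
  finally show "((\<lambda>t. f (x - t)) has_integral integral {0..x} f) {0..x}" by simp
qed

text \<open>
  Up to the reflection \<open>t \<mapsto> x - t\<close> and \<open>\<Gamma>(1 - \<alpha>) = - \<alpha> \<Gamma>(- \<alpha>)\<close>, the integral in the
  Caputo derivative is the one left over when the divergent integral is regularised by parts.
\<close>
lemma caputo_deriv_eq_sing_chain:
  assumes "0 < \<alpha>" "\<alpha> < 1" "x > 0" "smooth_on {0..x} y"
  shows "Gamma (- \<alpha>) * caputo_deriv \<alpha> y x - y 0 / (\<alpha> * x powr \<alpha>)
    = sing_chain \<alpha> (\<lambda>k t. (-1) ^ k * nth_deriv_on {0..x} k y (x - t)) 0 x"
proof -
  define \<phi> where "\<phi> = (\<lambda>k t. (-1) ^ k * nth_deriv_on {0..x} k y (x - t))"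
  have "is_jet x \<phi>" unfolding \<phi>_def by (rule reflected_derivs_is_jet[OF assms(4)])
  then have "(\<lambda>\<tau>. \<tau> powr (- \<alpha>) * \<phi> 1 \<tau>) integrable_on {0..x}"
    using assms is_jet_continuous by (intro integrable_powr_mult) auto
  from integral_reflect_interval[OF this]
  have "integral {0..x} (\<lambda>\<tau>. \<tau> powr (- \<alpha>) * \<phi> 1 \<tau>)
      = integral {0..x} (\<lambda>t. - (nth_deriv_on {0..x} 1 y t / (x - t) powr \<alpha>))"
    by (simp add: \<phi>_def powr_minus_divide)
  also have "\<dots> = - integral {0..x} (\<lambda>t. nth_deriv_on {0..x} 1 y t / (x - t) powr \<alpha>)"
    by simp
  also have "\<dots> = - (Gamma (1 - \<alpha>) * caputo_deriv \<alpha> y x)"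
    using Gamma_real_pos[of "1 - \<alpha>", THEN less_imp_neq] assms by (simp add: caputo_deriv_def)
  also have "Gamma (1 - \<alpha>) = - \<alpha> * Gamma (- \<alpha>)"
  proof -
    have "- \<alpha> \<notin> \<int>\<^sub>\<le>\<^sub>0"
    proof
      assume "- \<alpha> \<in> \<int>\<^sub>\<le>\<^sub>0"
      then obtain n where "- \<alpha> = - real n" by (auto elim!: nonpos_Ints_cases')
      with assms show False by (cases n) auto
    qed
    from Gamma_plus1[OF this] show ?thesis by (simp add: add.commute)
  qed
  finally have "integral {0..x} (\<lambda>\<tau>. \<tau> powr (- \<alpha>) * \<phi> 1 \<tau>) = \<alpha> * (Gamma (- \<alpha>) * caputo_deriv \<alpha> y x)"
    by simp
  then show ?thesis
    using assms unfolding \<phi>_def[symmetric]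
    by (simp add: \<phi>_def[THEN fun_cong, THEN fun_cong, of 0] powr_minus_divide field_simps)
qed

text \<open>
  In the Leibniz sum the signs \<open>(-1) ^ k\<close> from differentiating the power and
  \<open>(-1) ^ (2*m-1-k)\<close> from the reflection of \<open>y\<close> always multiply to \<open>-1\<close>.
\<close>
lemma sing_chain_even:
  assumes "0 < \<alpha>" "m \<ge> 1"
  shows "sing_chain \<alpha> (\<lambda>k t. (-1) ^ k * nth_deriv_on {0..x} k y (x - t)) (2 * m) x
    = - (\<Sum>k=0..2*m-1. real ((2*m-1) choose k) * (Gamma (1 + \<alpha> + real k) / Gamma (1 + \<alpha>))
          * (nth_deriv_on {0..x} (2*m-1-k) y 0 / x powr (1 + \<alpha> + real k)))"
proof -
  obtain p where p: "2 * m = Suc p" using assms by (cases "2 * m") auto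
  then have "odd p" by presburger
  have summand: "real (p choose j) * sing_power \<alpha> j x * ((-1) ^ (p - j) * z)
      = - (real (p choose j) * (Gamma (1 + \<alpha> + real j) / Gamma (1 + \<alpha>)) * (z / x powr (1 + \<alpha> + real j)))"
    if "j \<le> p" for j z
  proof -
    have "1 + \<alpha> \<notin> \<int>\<^sub>\<le>\<^sub>0" using assms by (auto elim!: nonpos_Ints_cases')
    then have poch: "pochhammer (1 + \<alpha>) j = Gamma (1 + \<alpha> + real j) / Gamma (1 + \<alpha>)"
      by (rule pochhammer_Gamma)
    have sign: "(-1 :: real) ^ j * (-1) ^ (p - j) = -1"
      using that \<open>odd p\<close> by (simp flip: power_add)
    have pow: "x powr (- (1 + \<alpha>) - real j) = 1 / x powr (1 + \<alpha> + real j)"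
      using powr_minus_divide[of x "1 + \<alpha> + real j"] by (simp add: algebra_simps)
    have "real (p choose j) * sing_power \<alpha> j x * ((-1) ^ (p - j) * z)
      = ((-1) ^ j * (-1) ^ (p - j)) * (real (p choose j)
          * (Gamma (1 + \<alpha> + real j) / Gamma (1 + \<alpha>)) * (z / x powr (1 + \<alpha> + real j)))"
      unfolding sing_power_def poch pow by simp
    then show ?thesis unfolding sign by simp
  qed
  show ?thesis
    unfolding p sing_chain.simps diff_Suc_1 atLeast0AtMost sum_negf[symmetric]
    by (intro sum.cong refl) (use summand in simp)
qed

lemma sum_without_odd_terms:
  fixes g :: "nat \<Rightarrow> real"
  assumes "N \<ge> 1" "\<And>k. odd k \<Longrightarrow> k \<noteq> 1 \<Longrightarrow> g k = 0"
  shows "(\<Sum>k\<le>N. g k) = g 0 + g 1 + (\<Sum>m=1..N div 2. g (2 * m))"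
  using assms(1)
proof (induction N rule: nat_induct_at_least)
  case (Suc N)
  show ?case
  proof (cases "odd N")
    case True
    then have "Suc N div 2 = Suc (N div 2)" "2 * Suc (N div 2) = Suc N" by presburger+
    with Suc.IH show ?thesis by (simp del: mult_Suc_right)
  next
    case False
    then have "Suc N div 2 = N div 2" "g (Suc N) = 0"
      using Suc.hyps assms(2)[of "Suc N"] by auto
    with Suc.IH show ?thesis by simp
  qed
qed simp

theorem lemma13:
  fixes \<alpha> x :: real and y :: "real \<Rightarrow> real" and N :: nat
  assumes "0 < \<alpha>" and "\<alpha> < 1"
    and "x > 0"
    and "smooth_on {0..x} y"
    and "N \<ge> 1"
  shows
    "(\<lambda>n::nat. let h = x / real n in
        1 / h powr \<alpha> * (\<Sum>k=1..n-1. y (x - real k * h) / real k powr (1 + \<alpha>))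
        - (Gamma (- \<alpha>) * caputo_deriv \<alpha> y x
           - y 0 / (\<alpha> * x powr \<alpha>)
           - y 0 * h / (2 * x powr (1 + \<alpha>))
           + (\<Sum>m=0..N. (- 1) ^ m / fact m * Re (zeta (complex_of_real (1 + \<alpha> - real m)))
                * nth_deriv_on {0..x} m y x * h powr (real m - \<alpha>))
           - (\<Sum>m=1..N div 2. bernoulli (2 * m) / fact (2 * m)
                * (\<Sum>k=0..2*m-1. real ((2*m-1) choose k)
                     * (Gamma (1 + \<alpha> + real k) / Gamma (1 + \<alpha>))
                     * (nth_deriv_on {0..x} (2*m-1-k) y 0 / x powr (1 + \<alpha> + real k)))
                * h ^ (2 * m))))
     \<in> O(\<lambda>n. (x / real n) ^ N)"
    (is "?error \<in> _")
proof -
  define \<phi> where "\<phi> = (\<lambda>k t. (-1) ^ k * nth_deriv_on {0..x} k y (x - t))"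
  define L where "L = (\<lambda>k. sing_chain \<alpha> \<phi> k x)"
  define Z where "Z = (\<lambda>m. \<phi> m 0 / fact m * Re (zeta (of_real (1 + \<alpha> - real m))))"
  define b where "b = (\<lambda>k. bernoulli k / fact k)"
  \<comment> \<open>One order more than asked for: the error \<open>h powr (K - \<alpha>)\<close> is then \<open>O(h ^ N)\<close> since \<open>\<alpha> < 1\<close>,
    and so are the extra terms of index \<open>K\<close> in both sums.\<close>
  define K where "K = Suc N"
  define rest where "rest = (\<lambda>n. em_defect \<alpha> x K \<phi> n
      - (\<Sum>m\<le>K. \<phi> m 0 / fact m * (Re (zeta (of_real (1 + \<alpha> - real m)))
          * (x / real n) powr (real m - \<alpha>))))"
  have jet: "is_jet x \<phi>" unfolding \<phi>_def by (rule reflected_derivs_is_jet[OF assms(4)])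
  have rest: "rest \<in> O(\<lambda>n. (x / real n) powr (real K - \<alpha>))"
    unfolding rest_def using assms jet by (intro em_defect_expansion) (auto simp: K_def)
  have error: "?error n = rest n + Z K * (x / real n) powr (real K - \<alpha>) + b K * L K * (x / real n) ^ K"
    if n: "n \<ge> 1" for n
  proof -
    define h where "h = x / real n"
    have h: "h > 0" using assms n by (simp add: h_def)
    have S: "1 / h powr \<alpha> * (\<Sum>k=1..n-1. y (x - real k * h) / real k powr (1 + \<alpha>))
        = (\<Sum>i=1..<n. h * sing_chain \<alpha> \<phi> 1 (real i * h))"
      unfolding sum_distrib_left
    proof (rule sum.cong)
      show "{1..n-1} = {1..<n}" using n by auto
      fix i assume "i \<in> {1..<n}"
      have "h * (real i * h) powr (- (1 + \<alpha>)) = h * h powr (- (1 + \<alpha>)) * real i powr (- (1 + \<alpha>))"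
        using h by (simp add: powr_mult)
      also have "h * h powr (- (1 + \<alpha>)) = h powr (- \<alpha>)"
        using h by (simp add: powr_mult_base)
      finally have "h * (real i * h) powr (- (1 + \<alpha>)) = h powr (- \<alpha>) * real i powr (- (1 + \<alpha>))" .
      moreover have "h * sing_chain \<alpha> \<phi> 1 (real i * h)
          = h * (real i * h) powr (- (1 + \<alpha>)) * y (x - real i * h)"
        by (simp add: sing_power_def \<phi>_def)
      ultimately show "1 / h powr \<alpha> * (y (x - real i * h) / real i powr (1 + \<alpha>))
          = h * sing_chain \<alpha> \<phi> 1 (real i * h)"
        by (simp only: powr_minus_divide) simp
    qed
    define E where "E = (\<Sum>m=1..N div 2. bernoulli (2 * m) / fact (2 * m)
                * (\<Sum>k=0..2*m-1. real ((2*m-1) choose k)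
                     * (Gamma (1 + \<alpha> + real k) / Gamma (1 + \<alpha>))
                     * (nth_deriv_on {0..x} (2*m-1-k) y 0 / x powr (1 + \<alpha> + real k)))
                * h ^ (2 * m))"
    have "(\<Sum>k\<le>N. b k * h ^ k * L k)
        = b 0 * h ^ 0 * L 0 + b 1 * h ^ 1 * L 1 + (\<Sum>m=1..N div 2. b (2 * m) * h ^ (2 * m) * L (2 * m))"
      using assms by (intro sum_without_odd_terms) (auto simp: b_def bernoulli_odd_eq_0)
    also have "b 0 * h ^ 0 * L 0 = Gamma (- \<alpha>) * caputo_deriv \<alpha> y x - y 0 / (\<alpha> * x powr \<alpha>)"
      using caputo_deriv_eq_sing_chain[OF assms(1-4)] by (simp add: b_def L_def \<phi>_def)
    also have "b 1 * h ^ 1 * L 1 = - (y 0 * h / (2 * x powr (1 + \<alpha>)))"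
      using powr_minus_divide[of x "1 + \<alpha>"]
      by (simp add: b_def L_def sing_power_def \<phi>_def)
    also have "(\<Sum>m=1..N div 2. b (2 * m) * h ^ (2 * m) * L (2 * m))
        = - E"
      unfolding E_def sum_negf[symmetric]
    proof (intro sum.cong refl)
      fix m assume "m \<in> {1..N div 2}"
      then have "m \<ge> 1" by simp
      show "b (2 * m) * h ^ (2 * m) * L (2 * m) = - (bernoulli (2 * m) / fact (2 * m)
                * (\<Sum>k=0..2*m-1. real ((2*m-1) choose k)
                     * (Gamma (1 + \<alpha> + real k) / Gamma (1 + \<alpha>))
                     * (nth_deriv_on {0..x} (2*m-1-k) y 0 / x powr (1 + \<alpha> + real k)))
                * h ^ (2 * m))"
        unfolding b_def L_def \<phi>_def sing_chain_even[OF assms(1) \<open>m \<ge> 1\<close>] by (simp only: mult_minus_right mult_ac)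
    qed
    finally have bdry: "(\<Sum>k\<le>N. b k * h ^ k * L k)
        = Gamma (- \<alpha>) * caputo_deriv \<alpha> y x - y 0 / (\<alpha> * x powr \<alpha>)
          + - (y 0 * h / (2 * x powr (1 + \<alpha>))) + - E" .
    have zsum: "(\<Sum>m=0..N. (- 1) ^ m / fact m * Re (zeta (complex_of_real (1 + \<alpha> - real m)))
                * nth_deriv_on {0..x} m y x * h powr (real m - \<alpha>))
        = (\<Sum>m\<le>N. Z m * h powr (real m - \<alpha>))"
      by (simp add: Z_def \<phi>_def mult_ac atLeast0AtMost)
    have "rest n = (\<Sum>i=1..<n. h * sing_chain \<alpha> \<phi> 1 (real i * h))
        - ((\<Sum>k\<le>N. b k * h ^ k * L k) + b K * h ^ K * L K)
        - ((\<Sum>m\<le>N. Z m * h powr (real m - \<alpha>)) + Z K * h powr (real K - \<alpha>))"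
      unfolding rest_def em_defect_def h_def[symmetric] b_def L_def Z_def K_def
      by (simp only: sum.atMost_Suc mult.assoc)
    then show ?thesis
      unfolding Let_def h_def[symmetric] S zsum E_def[symmetric] bdry
      by (simp add: algebra_simps)
  qed
  have powr_O: "(\<lambda>n. (x / real n) powr (real K - \<alpha>)) \<in> O(\<lambda>n. (x / real n) ^ N)"
  proof (rule bigoI[of _ "x powr (1 - \<alpha>)"], rule eventually_sequentiallyI[of 1])
    fix n :: nat assume n: "n \<ge> 1"
    define h where "h = x / real n"
    have h: "0 < h" "h \<le> x" using assms n by (simp_all add: h_def field_simps)
    have "h powr (real K - \<alpha>) = h powr (1 - \<alpha> + real N)" by (simp add: K_def algebra_simps)
    also have "\<dots> = h powr (1 - \<alpha>) * h ^ N" using h by (simp only: powr_add powr_realpow)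
    also have "\<dots> \<le> x powr (1 - \<alpha>) * h ^ N"
      using h assms by (intro mult_right_mono powr_mono2) auto
    finally show "norm ((x / real n) powr (real K - \<alpha>)) \<le> x powr (1 - \<alpha>) * norm ((x / real n) ^ N)"
      using h by (simp add: h_def[symmetric])
  qed
  have pow_O: "(\<lambda>n. (x / real n) ^ K) \<in> O(\<lambda>n. (x / real n) ^ N)"
  proof (rule bigoI[of _ x], rule eventually_sequentiallyI[of 1])
    fix n :: nat assume n: "n \<ge> 1"
    define h where "h = x / real n"
    have "0 \<le> h" "h \<le> x" using assms n by (simp_all add: h_def field_simps)
    then show "norm ((x / real n) ^ K) \<le> x * norm ((x / real n) ^ N)"
      by (simp add: K_def mult_right_mono abs_mult flip: h_def)
  qed
  have "(\<lambda>n. rest n + Z K * (x / real n) powr (real K - \<alpha>) + b K * L K * (x / real n) ^ K)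
      \<in> O(\<lambda>n. (x / real n) ^ N)"
    by (intro sum_in_bigo(1) landau_o.big_trans[OF rest powr_O]
        landau_o.big.cmult_in_iff'[THEN iffD2] powr_O pow_O) (simp_all add: powr_O pow_O)
  then show ?thesis
    by (rule landau_o.big.in_cong[THEN iffD2, rotated])
      (use error in \<open>auto intro!: eventually_sequentiallyI[of 1]\<close>)
qed

end
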